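(* Let $(x_k)_{k\ge0}$ be generated by Nonmonotone LiBCoD (described in the context). Suppose that the level set $\mathcal{L}_\varphi(x_0)=\{x:\varphi(x)\le\varphi(x_0)\}$ is compact, that Assumption A (stated in the context) holds on $\mathcal{C}=\mathcal{L}_\varphi(x_0)$, and that $g$ is bounded from below by an affine function. Then $$\lim_{k\to\infty}\mathbb{E}\left[\operatorname{dist}(0,\partial\varphi(x_k))\right]=0.$$
   Context: Norms are Euclidean (spectral for matrices), and $\operatorname{dist}(x,A)=\min_{a\in A}\|x-a\|$. Problem. Write $n=\sum_{i=1}^{n_{\text{block}}}n_i$ and $x=(x^1,\dots,x^{n_{\text{block}}})$ with $x^i\in\mathbb{R}^{n_i}$. Consider $\min_{x\in\operatorname{dom}\varphi}\varphi(x)$, where $\varphi(x):=f(x)+h(F(x))+g(x)$, $g(x):=\sum_{i=1}^{n_{\text{block}}}g_i(x^i)$, $f$ (real-valued) and $F=(F_1,\dots,F_m)$ ($\mathbb{R}^m$-valued) are differentiable on $\operatorname{dom}\varphi$, $h:\mathbb{R}^m\to\mathbb{R}$, and $g_i:\mathbb{R}^{n_i}\to\mathbb{R}\cup\{+\infty\}$. $\nabla_i$ denotes the gradient/Jacobian with respect to block $i$. $\partial\varphi$ is the limiting (Mordukhovich) subdifferential, so $\partial\varphi(x)=\nabla f(x)+\nabla F(x)^T\nabla h(F(x))+\partial g(x)$ with $\partial g(x)=\prod_i\partial g_i(x^i)$. Assumption A on a compact set $\mathcal{C}$. (1) For every block $i$ there are constants $L_i^f$, $L_i^{F_j}$ such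 that for all $x,y\in\mathcal{C}$: $\|\nabla_if(x)-\nabla_if(y)\|\le L_i^f\|x-y\|$ and $\|\nabla_iF_j(x)-\nabla_iF_j(y)\|\le L_i^{F_j}\|x-y\|$ for $j=1,\dots,m$. (2) $h$ is convex and differentiable with $\|\nabla h(u)-\nabla h(v)\|\le L_h\|u-v\|$ for all $u,v\in\mathbb{R}^m$. (3) Each $g_i$ is proper, lower semicontinuous and convex. (4) There are constants $f^*,h^*,g^*$ with $f(x)\ge f^*$, $g(x)\ge g^*$ for all $x\in\mathcal{C}$ and $h(u)\ge h^*$ for all $u\in\mathbb{R}^m$. Nonmonotone LiBCoD. Input: $x_0\in\operatorname{dom}\varphi$, $\beta_1\ge\beta_{\min}/2>0$, $p_{\min},u_{\min}\in(0,1)$, $\mathcal{R}_0=\varphi(x_0)$. For $k=0,1,2,\dots$: draw (afresh at each iteration) a random index $i_k\in\{1,\dots,n_{\text{block}}\}$, where $i$ is picked with probability $p_i\ge p_{\min}$. Then repeat: replace $\beta_{k+1}$ by $2\beta_{k+1}$; compute $$s_{k+1}=\arg\min_{s\in\mathbb{R}^{n_{i_k}}}\ \langle\nabla_{i_k}f(x_k),s-x_k^{i_k}\rangle+h\big(F(x_k)+\nabla_{i_k}F(x_k)(s-x_k^{i_k})\big)+g_{i_k}(s)+\tfrac{\beta_{k+1}}{2}\|s-x_k^{i_k}\|^2;$$ set $x_{k+1}^{i_k}=s_{k+1}$ and $x_{k+1}^i=x_k^i$ for $i\ne i_k$; until $\varphi(x_{k+1})\le\mathcal{R}_k-\frac{\beta_{k+1}}{2}\|x_{k+1}-x_k\|^2$.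 Then choose $u_{k+1}\in(u_{\min},1)$ and set $\mathcal{R}_{k+1}=(1-u_{k+1})\mathcal{R}_k+u_{k+1}\varphi(x_{k+1})$; the starting value of the regularization parameter for the next iteration is $\max\{\beta_{k+1}/4,\ \beta_{\min}/2\}$. $\mathbb{E}$ is the expectation over the random choice of the blocks.
   Formalization: Since ∂φ(x_k) can be empty with positive probability (e.g. g_i(t)=-√t on [0,1], x_0^i=0), where dist(0,∂φ(x_k)) is undefined, dist is set to 0 when ∂φ(x_k) is empty, and it is proved in addition that P(∂φ(x_k)=∅)→0. *)

theory Defs
  imports "HOL-Probability.Probability"
begin

section \<open>Extended-valued functions\<close>

definition proper_on :: "'a set \<Rightarrow> ('a \<Rightarrow> ereal) \<Rightarrow> bool" where
  "proper_on S g \<longleftrightarrow> (\<forall>s\<in>S. g s \<noteq> -\<infinity>) \<and> (\<exists>s\<in>S. g s \<noteq> \<infinity>)"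

definition lsc_on :: "'a::topological_space set \<Rightarrow> ('a \<Rightarrow> ereal) \<Rightarrow> bool" where
  "lsc_on S g \<longleftrightarrow> (\<forall>s\<in>S. g s \<le> Liminf (at s within S) g)"

definition ereal_convex_on :: "'a::real_vector set \<Rightarrow> ('a \<Rightarrow> ereal) \<Rightarrow> bool" where
  "ereal_convex_on S g \<longleftrightarrow> convex S \<and>
     (\<forall>s\<in>S. \<forall>t\<in>S. \<forall>a. 0 < a \<and> a < 1 \<longrightarrow>
        g ((1 - a) *\<^sub>R s + a *\<^sub>R t) \<le> ereal (1 - a) * g s + ereal a * g t)"

definition edom :: "('a \<Rightarrow> ereal) \<Rightarrow> 'a set" where
  "edom \<phi> = {x. \<phi> x < \<infinity>}"

definition frechet_subdiff :: "('a::euclidean_space \<Rightarrow> ereal) \<Rightarrow> 'a \<Rightarrow> 'a set" where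
  "frechet_subdiff \<phi> x = {v. \<bar>\<phi> x\<bar> \<noteq> \<infinity> \<and>
     0 \<le> Liminf (at x) (\<lambda>y. (\<phi> y - \<phi> x - ereal (v \<bullet> (y - x))) / ereal (norm (y - x)))}"

definition limiting_subdiff :: "('a::euclidean_space \<Rightarrow> ereal) \<Rightarrow> 'a \<Rightarrow> 'a set" where
  "limiting_subdiff \<phi> x = {v. \<bar>\<phi> x\<bar> \<noteq> \<infinity> \<and>
     (\<exists>y w. y \<longlonglongrightarrow> x \<and> (\<lambda>k. \<phi> (y k)) \<longlonglongrightarrow> \<phi> x \<and>
            (\<forall>k. w k \<in> frechet_subdiff \<phi> (y k)) \<and> w \<longlonglongrightarrow> v)}"

section \<open>Block structure\<close>

text \<open>The map \<open>blk\<close> sends each coordinate of \<open>real ^ 'n\<close> to the block it belongs to; the number of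
  blocks is \<open>CARD('b)\<close>. The \<open>i\<close>-th factor, of dimension \<open>card {j. blk j = i}\<close>, is identified with
  the subspace \<open>block_space blk i\<close> of vectors vanishing outside block \<open>i\<close>, and \<open>block_part blk i x\<close>
  is the component of \<open>x\<close> in it. A function on the \<open>i\<close>-th factor is a function on \<open>real ^ 'n\<close> that
  is only evaluated on \<open>block_space blk i\<close>.\<close>

definition block_space :: "('n::finite \<Rightarrow> 'b) \<Rightarrow> 'b \<Rightarrow> (real ^ 'n) set" where
  "block_space blk i = {v. \<forall>j. blk j \<noteq> i \<longrightarrow> v $ j = 0}"

definition block_part :: "('n::finite \<Rightarrow> 'b) \<Rightarrow> 'b \<Rightarrow> real ^ 'n \<Rightarrow> real ^ 'n" where
  "block_part blk i x = (\<chi> j. if blk j = i then x $ j else 0)"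

definition grad :: "('a::real_inner \<Rightarrow> real) \<Rightarrow> 'a \<Rightarrow> 'a" where
  "grad f x = (THE D. GDERIV f x :> D)"

definition block_grad ::
  "('n::finite \<Rightarrow> 'b) \<Rightarrow> 'b \<Rightarrow> (real ^ 'n \<Rightarrow> real) \<Rightarrow> real ^ 'n \<Rightarrow> real ^ 'n" where
  "block_grad blk i f x = block_part blk i (grad f x)"

text \<open>The Jacobian with respect to block \<open>i\<close> keeps all columns; those outside the block are zero.\<close>

definition block_jac ::
  "('n::finite \<Rightarrow> 'b) \<Rightarrow> 'b \<Rightarrow> (real ^ 'n \<Rightarrow> real ^ 'm) \<Rightarrow> real ^ 'n \<Rightarrow> real ^ 'n ^ 'm" where
  "block_jac blk i F x = (\<chi> j. block_grad blk i (\<lambda>y. F y $ j) x)"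

definition block_sum ::
  "('n::finite \<Rightarrow> 'b::finite) \<Rightarrow> ('b \<Rightarrow> real ^ 'n \<Rightarrow> ereal) \<Rightarrow> real ^ 'n \<Rightarrow> ereal" where
  "block_sum blk g x = (\<Sum>i\<in>UNIV. g i (block_part blk i x))"

definition objective ::
  "('n::finite \<Rightarrow> 'b::finite) \<Rightarrow> (real ^ 'n \<Rightarrow> real) \<Rightarrow> (real ^ 'n \<Rightarrow> real ^ 'm) \<Rightarrow>
   (real ^ 'm \<Rightarrow> real) \<Rightarrow> ('b \<Rightarrow> real ^ 'n \<Rightarrow> ereal) \<Rightarrow> real ^ 'n \<Rightarrow> ereal" where
  "objective blk f F h g x = ereal (f x + h (F x)) + block_sum blk g x"

section \<open>One iteration of LiBCoD\<close>

definition block_model ::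
  "('n::finite \<Rightarrow> 'b::finite) \<Rightarrow> (real ^ 'n \<Rightarrow> real) \<Rightarrow> (real ^ 'n \<Rightarrow> real ^ 'm) \<Rightarrow>
   (real ^ 'm \<Rightarrow> real) \<Rightarrow> ('b \<Rightarrow> real ^ 'n \<Rightarrow> ereal) \<Rightarrow>
   'b \<Rightarrow> real ^ 'n \<Rightarrow> real \<Rightarrow> real ^ 'n \<Rightarrow> ereal" where
  "block_model blk f F h g i x \<beta> s =
     ereal (block_grad blk i f x \<bullet> (s - block_part blk i x)
            + h (F x + block_jac blk i F x *v (s - block_part blk i x)))
     + g i s + ereal (\<beta> / 2 * (norm (s - block_part blk i x))\<^sup>2)"

definition trial_point ::
  "('n::finite \<Rightarrow> 'b::finite) \<Rightarrow> (real ^ 'n \<Rightarrow> real) \<Rightarrow> (real ^ 'n \<Rightarrow> real ^ 'm) \<Rightarrow>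
   (real ^ 'm \<Rightarrow> real) \<Rightarrow> ('b \<Rightarrow> real ^ 'n \<Rightarrow> ereal) \<Rightarrow>
   'b \<Rightarrow> real ^ 'n \<Rightarrow> real \<Rightarrow> real ^ 'n \<Rightarrow> bool" where
  "trial_point blk f F h g i x \<beta> y \<longleftrightarrow>
     is_arg_min (block_model blk f F h g i x \<beta>) (\<lambda>s. s \<in> block_space blk i) (block_part blk i y) \<and>
     (\<forall>l. l \<noteq> i \<longrightarrow> block_part blk l y = block_part blk l x)"

definition accepted ::
  "(real ^ 'n \<Rightarrow> ereal) \<Rightarrow> real ^ 'n \<Rightarrow> real \<Rightarrow> real \<Rightarrow> real ^ 'n \<Rightarrow> bool" where
  "accepted \<phi> x R \<beta> y \<longleftrightarrow> \<phi> y \<le> ereal (R - \<beta> / 2 * (norm (y - x))\<^sup>2)"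

text \<open>\<open>line_search blk f F h g i x R b \<beta> y\<close>: the repeat-until loop on block \<open>i\<close> at \<open>x\<close> with
  reference value \<open>R\<close>, entered with regularization parameter \<open>b\<close>, stops with parameter \<open>\<beta>\<close> at the
  point \<open>y\<close>. The parameter is doubled before every trial, also the first one.\<close>

inductive line_search ::
  "('n::finite \<Rightarrow> 'b::finite) \<Rightarrow> (real ^ 'n \<Rightarrow> real) \<Rightarrow> (real ^ 'n \<Rightarrow> real ^ 'm) \<Rightarrow>
   (real ^ 'm \<Rightarrow> real) \<Rightarrow> ('b \<Rightarrow> real ^ 'n \<Rightarrow> ereal) \<Rightarrow>
   'b \<Rightarrow> real ^ 'n \<Rightarrow> real \<Rightarrow> real \<Rightarrow> real \<Rightarrow> real ^ 'n \<Rightarrow> bool"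
  for blk f F h g i x R
where
  stop: "trial_point blk f F h g i x (2 * b) y \<Longrightarrow>
         accepted (objective blk f F h g) x R (2 * b) y \<Longrightarrow>
         line_search blk f F h g i x R b (2 * b) y"
| retry: "trial_point blk f F h g i x (2 * b) z \<Longrightarrow>
          \<not> accepted (objective blk f F h g) x R (2 * b) z \<Longrightarrow>
          line_search blk f F h g i x R (2 * b) \<beta> y \<Longrightarrow>
          line_search blk f F h g i x R b \<beta> y"

section \<open>Nonmonotone LiBCoD\<close>

text \<open>The algorithm run on a probability space \<open>M\<close>: \<open>I k\<close> is the block drawn in iteration \<open>k\<close>,
  \<open>b k\<close> the regularization parameter with which iteration \<open>k\<close> starts, and \<open>\<beta> (Suc k)\<close> the one
  accepted in it (\<open>\<beta> 0\<close> is unused). \<open>G k\<close> is the information available before the draw in iteration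
  \<open>k\<close>: the draw is independent of it, whereas \<open>u (Suc k)\<close> may depend on everything up to and
  including that draw.\<close>

definition nonmonotone_libcod ::
  "('n::finite \<Rightarrow> 'b::finite) \<Rightarrow> (real ^ 'n \<Rightarrow> real) \<Rightarrow> (real ^ 'n \<Rightarrow> real ^ 'm) \<Rightarrow>
   (real ^ 'm \<Rightarrow> real) \<Rightarrow> ('b \<Rightarrow> real ^ 'n \<Rightarrow> ereal) \<Rightarrow>
   real ^ 'n \<Rightarrow> real \<Rightarrow> real \<Rightarrow> real \<Rightarrow> real \<Rightarrow> ('b \<Rightarrow> real) \<Rightarrow>
   'w measure \<Rightarrow> (nat \<Rightarrow> 'w measure) \<Rightarrow> (nat \<Rightarrow> 'w \<Rightarrow> 'b) \<Rightarrow> (nat \<Rightarrow> 'w \<Rightarrow> real) \<Rightarrow>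
   (nat \<Rightarrow> 'w \<Rightarrow> real) \<Rightarrow> (nat \<Rightarrow> 'w \<Rightarrow> real) \<Rightarrow> (nat \<Rightarrow> 'w \<Rightarrow> real) \<Rightarrow>
   (nat \<Rightarrow> 'w \<Rightarrow> real ^ 'n) \<Rightarrow> bool" where
  "nonmonotone_libcod blk f F h g x\<^sub>0 \<beta>\<^sub>1 \<beta>min pmin umin p M G I u b \<beta> R x \<longleftrightarrow>
     x\<^sub>0 \<in> edom (objective blk f F h g) \<and> \<beta>\<^sub>1 \<ge> \<beta>min / 2 \<and> \<beta>min / 2 > 0 \<and>
     0 < pmin \<and> pmin < 1 \<and> 0 < umin \<and> umin < 1 \<and> (\<forall>i. p i \<ge> pmin) \<and>
     prob_space M \<and> filtration (space M) G \<and> (\<forall>k. subalgebra M (G k)) \<and>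
     (\<forall>k. I k \<in> measurable (G (Suc k)) (count_space UNIV)) \<and>
     (\<forall>k. u (Suc k) \<in> borel_measurable (G (Suc k))) \<and>
     (\<forall>k i. \<forall>A\<in>sets (G k). measure M (A \<inter> {\<omega>\<in>space M. I k \<omega> = i}) = measure M A * p i) \<and>
     (\<forall>\<omega>\<in>space M.
        x 0 \<omega> = x\<^sub>0 \<and> b 0 \<omega> = \<beta>\<^sub>1 \<and> ereal (R 0 \<omega>) = objective blk f F h g x\<^sub>0 \<and>
        (\<forall>k. line_search blk f F h g (I k \<omega>) (x k \<omega>) (R k \<omega>) (b k \<omega>)
               (\<beta> (Suc k) \<omega>) (x (Suc k) \<omega>) \<and>
             umin < u (Suc k) \<omega> \<and> u (Suc k) \<omega> < 1 \<and>
             ereal (R (Suc k) \<omega>) = ereal ((1 - u (Suc k) \<omega>) * R k \<omega>)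
               + ereal (u (Suc k) \<omega>) * objective blk f F h g (x (Suc k) \<omega>) \<and>
             b (Suc k) \<omega> = max (\<beta> (Suc k) \<omega> / 4) (\<beta>min / 2)))"

section \<open>Assumptions on the problem\<close>

definition assumption_A ::
  "('n::finite \<Rightarrow> 'b::finite) \<Rightarrow> (real ^ 'n \<Rightarrow> real) \<Rightarrow> (real ^ 'n \<Rightarrow> real ^ 'm) \<Rightarrow>
   (real ^ 'm \<Rightarrow> real) \<Rightarrow> ('b \<Rightarrow> real ^ 'n \<Rightarrow> ereal) \<Rightarrow> (real ^ 'n) set \<Rightarrow> bool" where
  "assumption_A blk f F h g C \<longleftrightarrow>
     (\<forall>i. (\<exists>L. L-lipschitz_on C (block_grad blk i f)) \<and>
          (\<forall>j. \<exists>L. L-lipschitz_on C (block_grad blk i (\<lambda>x. F x $ j)))) \<and>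
     convex_on UNIV h \<and> (\<forall>v. h differentiable (at v)) \<and> (\<exists>L. L-lipschitz_on UNIV (grad h)) \<and>
     (\<forall>i. proper_on (block_space blk i) (g i) \<and> lsc_on (block_space blk i) (g i) \<and>
          ereal_convex_on (block_space blk i) (g i)) \<and>
     (\<exists>fl hl gl :: real. (\<forall>x\<in>C. fl \<le> f x \<and> ereal gl \<le> block_sum blk g x) \<and> (\<forall>v. hl \<le> h v))"

section \<open>Distance to stationarity\<close>

text \<open>Pitfall: \<open>infdist 0 {} = 0\<close>. The limiting subdifferential can be empty at the starting point,
  and then also at every iterate some block of which has not been drawn yet, so a statement about
  \<open>stat_dist\<close> has to be accompanied by one about the event that the subdifferential is empty.\<close>

definition stat_dist :: "('a::euclidean_space \<Rightarrow> ereal) \<Rightarrow> 'a \<Rightarrow> real" where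
  "stat_dist \<phi> x = infdist 0 (limiting_subdiff \<phi> x)"

end

(*
  Along every run the reference values R_k decrease by at least a multiple of |x_{k+1} - x_k|^2 and
  are bounded from below. The accepted regularization parameters are bounded: for large beta the
  segment from x_k to the trial point cannot leave the level set, so the descent lemma applies on it.
  Optimality of the trial point then makes the residual of the block just drawn at most
  e + K (R_k - R_{k+1}), and the residuals of the other blocks grow by at most that much. As block i
  is drawn independently of the past with probability p_i, its expected residual a_k satisfies
  a_{k+1} <= (1 - p_i) a_k + e + K E[R_k - R_{k+1}], whose last term tends to 0; hence
  limsup a_k <= 3 e / p_i for every e > 0.
*)

theory Submission
  imports Defs
begin

text \<open>The step length enters the residual linearly, while the decrease of \<open>R\<close>
  controls only its square; trading one for the other costs part of e. The rest of e pays for the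
  gradient of the smooth part, which is merely known to be uniformly continuous on a possibly
  nonconvex level set. These errors pile up in a block that is not drawn, and a draw erases them, so
  in expectation they stay of order e / p_i. A block not yet drawn may have no subgradient of g_i at
  all. The subdifferential is then empty and \<open>stat_dist\<close> is 0 by convention, which is
  why a second limit accompanies the first: emptiness forces some block to be undrawn, an event of
  probability at most the sum of the (1 - p_i)^k. Showing the emptiness needs \<open>gS\<close>
  continuous along the sequences that define limiting subgradients, hence a value strictly below
  that of the starting point; the acceptance test leaves the starting point as the only iterate at
  its own level. Independence is applied to scalar recursions in the draws and the reference values.
  Their measurability rests on the fact that only countably many states (x, b) can occur, although
  \<open>R\<close> ranges over a continuum.\<close>

section \<open>Real functions and probability\<close>

text \<open>Here \<open>q\<close> is a smooth function along a segment, and \<open>a\<close>,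
  \<open>c\<close> are the end values of a convex one, bounded by its chord. Near 0 only the slope
  of \<open>q\<close> survives. The slack \<open>e * t\<close> admits inequalities that hold up to
  o(t), as for Frechet subgradients.\<close>

lemma directional_first_order_condition:
  fixes q :: "real \<Rightarrow> real"
  assumes q: "(q has_real_derivative D) (at 0)"
    and ev: "\<And>e. e > 0 \<Longrightarrow>
      eventually (\<lambda>t. q t + (1 - t) * a + t * c \<ge> q 0 + a - e * t) (at_right 0)"
  shows "a \<le> c + D"
proof (rule field_le_epsilon)
  fix e :: real assume e: "0 < e"
  have lim: "((\<lambda>t. (q t - q 0) / t) \<longlongrightarrow> D) (at_right 0)"
    using q unfolding DERIV_def by (auto intro: tendsto_mono[rotated] at_le)
  have "eventually (\<lambda>t. a - c - e \<le> (q t - q 0) / t) (at_right 0)"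
    using ev[OF e] eventually_at_right_less[of 0]
  proof eventually_elim
    case (elim t)
    then have "(a - c - e) * t \<le> q t - q 0" by (simp add: algebra_simps)
    then show ?case using elim(2) by (simp add: pos_le_divide_eq)
  qed
  then have "a - c - e \<le> D"
    using lim by (intro tendsto_lowerbound) auto
  then show "a \<le> c + D + e" by simp
qed

text \<open>Correcting the remainder by the quadratic on either side makes it monotone;
  \<open>q'\<close> is compared with its value at 0 only.\<close>

lemma taylor_remainder_bound:
  fixes q q' :: "real \<Rightarrow> real"
  assumes t: "0 \<le> t"
    and der: "\<And>\<tau>. 0 \<le> \<tau> \<Longrightarrow> \<tau> \<le> t \<Longrightarrow> (q has_real_derivative q' \<tau>) (at \<tau>)"
    and lip: "\<And>\<tau>. 0 \<le> \<tau> \<Longrightarrow> \<tau> \<le> t \<Longrightarrow> \<bar>q' \<tau> - q' 0\<bar> \<le> L * \<tau>"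
  shows "\<bar>q t - q 0 - t * q' 0\<bar> \<le> L / 2 * t\<^sup>2"
proof -
  have "q t - t * q' 0 - L / 2 * t\<^sup>2 \<le> q 0 - 0 * q' 0 - L / 2 * 0\<^sup>2"
  proof (rule DERIV_nonpos_imp_nonincreasing[OF t])
    fix \<tau> assume \<tau>: "0 \<le> \<tau>" "\<tau> \<le> t"
    have "((\<lambda>t. q t - t * q' 0 - L / 2 * t\<^sup>2) has_real_derivative q' \<tau> - q' 0 - L * \<tau>) (at \<tau>)"
      using der[OF \<tau>] by (auto intro!: derivative_eq_intros)
    then show "\<exists>y. ((\<lambda>t. q t - t * q' 0 - L / 2 * t\<^sup>2) has_real_derivative y) (at \<tau>) \<and> y \<le> 0"
      using lip[OF \<tau>] by (intro exI[of _ "q' \<tau> - q' 0 - L * \<tau>"]) (auto simp: abs_le_iff)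
  qed
  moreover have "q 0 - 0 * q' 0 + L / 2 * 0\<^sup>2 \<le> q t - t * q' 0 + L / 2 * t\<^sup>2"
  proof (rule DERIV_nonneg_imp_nondecreasing[OF t])
    fix \<tau> assume \<tau>: "0 \<le> \<tau>" "\<tau> \<le> t"
    have "((\<lambda>t. q t - t * q' 0 + L / 2 * t\<^sup>2) has_real_derivative q' \<tau> - q' 0 + L * \<tau>) (at \<tau>)"
      using der[OF \<tau>] by (auto intro!: derivative_eq_intros)
    then show "\<exists>y. ((\<lambda>t. q t - t * q' 0 + L / 2 * t\<^sup>2) has_real_derivative y) (at \<tau>) \<and> 0 \<le> y"
      using lip[OF \<tau>] by (intro exI[of _ "q' \<tau> - q' 0 + L * \<tau>"]) (auto simp: abs_le_iff)
  qed
  ultimately show ?thesis by (intro abs_leI) auto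
qed

text \<open>Continuous induction. The strict conclusion of \<open>step\<close> lets continuity carry
  the bound beyond any time reached; at time 0 there is equality, so the first move needs
  \<open>start\<close>.\<close>

lemma sublevel_continuation:
  fixes \<psi> :: "real \<Rightarrow> real"
  assumes cont: "continuous_on {0..1} \<psi>"
    and start: "eventually (\<lambda>t. \<psi> t \<le> \<psi> 0) (at_right 0)"
    and step: "\<And>t. 0 < t \<Longrightarrow> t \<le> 1 \<Longrightarrow> (\<And>\<tau>. 0 \<le> \<tau> \<Longrightarrow> \<tau> \<le> t \<Longrightarrow> \<psi> \<tau> \<le> \<psi> 0) \<Longrightarrow> \<psi> t < \<psi> 0"
    and t: "0 \<le> t" "t \<le> 1"
  shows "\<psi> t \<le> \<psi> 0"
proof (rule ccontr)
  assume bad: "\<not> \<psi> t \<le> \<psi> 0"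
  define B where "B = {s\<in>{0..1}. \<psi> s > \<psi> 0}"
  \<comment> \<open>The first exit time. The bound holds up to and including it by continuity from
    the left, and slightly beyond it, which contradicts the infimum.\<close>
  define t0 where "t0 = Inf B"
  have tB: "t \<in> B" using bad t by (auto simp: B_def)
  have bdd: "bdd_below B" by (auto simp: B_def bdd_below_def)
  have t0: "0 \<le> t0" "t0 \<le> t"
    unfolding t0_def using tB bdd by (auto intro!: cInf_greatest cInf_lower simp: B_def)
  have below: "\<psi> \<tau> \<le> \<psi> 0" if "0 \<le> \<tau>" "\<tau> < t0" for \<tau>
  proof (rule ccontr)
    assume "\<not> \<psi> \<tau> \<le> \<psi> 0"
    then have "\<tau> \<in> B" using that t0 t by (auto simp: B_def)
    then show False using cInf_lower[OF _ bdd, of \<tau>] that by (simp add: t0_def)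
  qed
  have at0: "\<psi> t0 \<le> \<psi> 0"
  proof (cases "t0 = 0")
    case False
    with t0 have pos: "0 < t0" by simp
    have "continuous (at t0 within {0..1}) \<psi>"
      using cont t0 t by (auto simp: continuous_on_eq_continuous_within)
    then have "(\<psi> \<longlongrightarrow> \<psi> t0) (at t0 within {0..<t0})"
      unfolding continuous_within using t0 t by (auto elim: tendsto_within_subset)
    moreover have "at t0 within {0..<t0} = at_left t0"
      using pos by (intro at_within_nhd[of t0 "{0<..}"]) auto
    ultimately have lim: "(\<psi> \<longlongrightarrow> \<psi> t0) (at_left t0)" by simp
    have "eventually (\<lambda>\<tau>. \<tau> \<in> {0<..<t0}) (at_left t0)"
      by (rule eventually_at_leftI[of 0]) (use pos in auto)
    then have "eventually (\<lambda>\<tau>. \<psi> \<tau> \<le> \<psi> 0) (at_left t0)"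
      by eventually_elim (use below in auto)
    with lim show ?thesis by (intro tendsto_upperbound) auto
  qed auto
  have lt: "t0 < t" using at0 bad t0 by (cases "t0 = t") auto
  have "eventually (\<lambda>s. \<psi> s \<le> \<psi> 0) (at_right t0)"
  proof (cases "t0 = 0")
    case True then show ?thesis using start by simp
  next
    case False
    have "\<psi> t0 < \<psi> 0"
      using False t0 t below at0 by (intro step) (auto simp: le_less)
    moreover have "(\<psi> \<longlongrightarrow> \<psi> t0) (at_right t0)"
    proof -
      have "continuous (at t0 within {0..1}) \<psi>"
        using cont t0 t by (auto simp: continuous_on_eq_continuous_within)
      then have "(\<psi> \<longlongrightarrow> \<psi> t0) (at t0 within {t0<..1})"
        unfolding continuous_within using t0 t by (auto elim: tendsto_within_subset)
      moreover have "at t0 within {t0<..1} = at_right t0"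
        using lt t by (intro at_within_nhd[of t0 "{..<1}"]) auto
      ultimately show ?thesis by simp
    qed
    ultimately show ?thesis
      by (auto dest: order_tendstoD(2) elim!: eventually_mono)
  qed
  then obtain b where b: "b > t0" "\<And>s. t0 < s \<Longrightarrow> s < b \<Longrightarrow> \<psi> s \<le> \<psi> 0"
    using eventually_at_right[OF lt] by auto
  obtain s where s: "s \<in> B" "s < b"
    using cInf_lessD[of B b] tB b(1) by (auto simp: t0_def)
  have "t0 \<le> s" using cInf_lower[OF s(1) bdd] by (simp add: t0_def)
  with s b(2)[of s] at0 show False by (cases "s = t0") (auto simp: B_def)
qed

text \<open>Points closer than the modulus d are handled by uniform continuity; for the others the
  oscillation is at most 2B, and the quadratic term is at least that large there.\<close>

lemma continuous_modulus_quadratic: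
  fixes \<psi> :: "'a::metric_space \<Rightarrow> 'b::real_normed_vector"
  assumes "compact C" "continuous_on C \<psi>" "0 < e"
  shows "\<exists>K\<ge>0. \<forall>x\<in>C. \<forall>y\<in>C. norm (\<psi> x - \<psi> y) \<le> e + K * (dist x y)\<^sup>2"
proof -
  have "uniformly_continuous_on C \<psi>" using assms compact_uniformly_continuous by blast
  then obtain d where d: "d > 0" "\<And>x y. x \<in> C \<Longrightarrow> y \<in> C \<Longrightarrow> dist y x < d \<Longrightarrow> dist (\<psi> y) (\<psi> x) < e"
    using \<open>0 < e\<close> unfolding uniformly_continuous_on_def by metis
  have "bounded (\<psi> ` C)" using assms compact_continuous_image compact_imp_bounded by blast
  then obtain B where B: "\<And>x. x \<in> C \<Longrightarrow> norm (\<psi> x) \<le> B" "B > 0"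
    unfolding bounded_pos by auto
  have "norm (\<psi> x - \<psi> y) \<le> e + 2 * B / d\<^sup>2 * (dist x y)\<^sup>2" if xy: "x \<in> C" "y \<in> C" for x y
  proof (cases "dist x y < d")
    case True
    then have "norm (\<psi> x - \<psi> y) \<le> e" using d(2)[OF xy(2,1)] by (simp add: dist_norm)
    moreover have "0 \<le> 2 * B / d\<^sup>2 * (dist x y)\<^sup>2" using B(2) by simp
    ultimately show ?thesis by linarith
  next
    case False
    then have "1 \<le> (dist x y)\<^sup>2 / d\<^sup>2" using d(1) by (simp add: power_mono)
    then have "2 * B * 1 \<le> 2 * B * ((dist x y)\<^sup>2 / d\<^sup>2)" using B(2) by (intro mult_left_mono) auto
    moreover have "norm (\<psi> x - \<psi> y) \<le> 2 * B"
      using norm_triangle_ineq4[of "\<psi> x" "\<psi> y"] B(1)[OF xy(1)] B(1)[OF xy(2)] by linarith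
    ultimately show ?thesis using \<open>0 < e\<close> by simp
  qed
  then show ?thesis using B(2) by (intro exI[of _ "2 * B / d\<^sup>2"]) auto
qed

text \<open>The square (e - c t)^2 is nonnegative; this is Young's inequality with its factor 1/2
  given away.\<close>

lemma linear_le_quadratic:
  fixes c t e :: real
  assumes "0 < e"
  shows "c * t \<le> e + c\<^sup>2 / e * t\<^sup>2"
proof -
  have "0 \<le> (e - c * t)\<^sup>2" by simp
  then have "c * t * (2 * e) \<le> e\<^sup>2 + c\<^sup>2 * t\<^sup>2" by (simp add: power2_eq_square algebra_simps)
  then have "2 * (c * t) \<le> e + c\<^sup>2 / e * t\<^sup>2"
    using assms by (simp add: field_simps power2_eq_square)
  moreover have "0 \<le> e + c\<^sup>2 / e * t\<^sup>2" using assms by simp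
  ultimately show ?thesis by linarith
qed

text \<open>Once \<open>c\<close> is below e, the recursion is dominated by one with fixed point
  2e/p; the excess over it shrinks geometrically, and another e/p absorbs what is left.\<close>

lemma affine_recursion_eventually_le:
  fixes a c :: "nat \<Rightarrow> real"
  assumes p: "0 < p" "p \<le> 1" and e: "0 < e"
    and rec: "\<And>k. a (Suc k) \<le> (1 - p) * a k + e + c k"
    and c: "c \<longlonglongrightarrow> 0"
  shows "eventually (\<lambda>k. a k \<le> 3 * e / p) sequentially"
proof -
  obtain N where N: "\<And>k. k \<ge> N \<Longrightarrow> c k \<le> e"
    using order_tendstoD(2)[OF c e] unfolding eventually_sequentially by (meson less_imp_le)
  define b where "b = max 0 (a N)"
  have bnd: "a (N + k) \<le> 2 * e / p + (1 - p) ^ k * b" for k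
  proof (induction k)
    case 0
    have "0 \<le> 2 * e / p" using p e by simp
    then show ?case unfolding b_def by (simp add: max_def)
  next
    case (Suc k)
    have "a (N + Suc k) \<le> (1 - p) * a (N + k) + e + c (N + k)" using rec[of "N + k"] by simp
    also have "\<dots> \<le> (1 - p) * (2 * e / p + (1 - p) ^ k * b) + e + e"
      using Suc p N[of "N + k"] by (intro add_mono mult_left_mono) auto
    also have "\<dots> = 2 * e / p + (1 - p) ^ Suc k * b"
      using p by (simp add: field_simps)
    finally show ?case .
  qed
  have "(\<lambda>k. (1 - p) ^ k) \<longlonglongrightarrow> 0" using p by (intro LIMSEQ_realpow_zero) auto
  then have "(\<lambda>k. (1 - p) ^ k * b) \<longlonglongrightarrow> 0 * b" by (rule tendsto_mult_right)
  then have "eventually (\<lambda>k. (1 - p) ^ k * b < e / p) sequentially"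
    using p e by (intro order_tendstoD(2)[where y = 0]) auto
  then have "eventually (\<lambda>k. a (k + N) \<le> 3 * e / p) sequentially"
  proof eventually_elim
    case (elim k)
    moreover have "3 * e / p = 2 * e / p + e / p" by (simp add: add_divide_distrib[symmetric])
    ultimately show ?case using bnd[of k] by (simp add: add.commute)
  qed
  then show ?thesis by (rule iffD1[OF eventually_sequentially_seg])
qed

text \<open>\<open>grad\<close> is a definite description, so both existence and uniqueness of the
  representing vector matter.\<close>

lemma grad_has_derivative:
  fixes q :: "'a::euclidean_space \<Rightarrow> real"
  assumes "q differentiable (at y)"
  shows "(q has_derivative (\<lambda>d. grad q y \<bullet> d)) (at y)"
proof -
  obtain q' where q': "(q has_derivative q') (at y)" using assms by (auto simp: differentiable_def)
  \<comment> \<open>The Riesz representer of the derivative: its adjoint applied to the scalar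
    1.\<close>
  define D where "D = adjoint q' 1"
  have "q' = (\<lambda>d. d \<bullet> D)"
    using adjoint_works[OF has_derivative_linear[OF q'], of _ 1] by (simp add: D_def)
  then have D: "GDERIV q y :> D" using q' by (simp add: gderiv_def)
  have "grad q y = D"
    unfolding grad_def
  proof (rule the_equality[of "\<lambda>D. GDERIV q y :> D", OF D])
    fix E assume "GDERIV q y :> E"
    then have "(\<lambda>d. d \<bullet> E) = (\<lambda>d. d \<bullet> D)"
      using D unfolding gderiv_def by (rule has_derivative_unique)
    then have "(E - D) \<bullet> E = (E - D) \<bullet> D" by metis
    then have "(E - D) \<bullet> (E - D) = 0" by (simp add: inner_diff_right)
    then show "E = D" by simp
  qed
  then show ?thesis using D by (simp add: gderiv_def inner_commute)
qed

text \<open>Along the segment h lies below its chord, so minus h plus the chord is smallest at t =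
  0, and its slope there is nonnegative.\<close>

lemma convex_on_above_gradient:
  fixes h :: "'a::euclidean_space \<Rightarrow> real"
  assumes cvx: "convex_on UNIV h" and diff: "h differentiable (at v)"
  shows "h v + grad h v \<bullet> (w - v) \<le> h w"
proof -
  have "h v \<le> h w + - (grad h v \<bullet> (w - v))"
  proof (rule directional_first_order_condition[where q = "\<lambda>t. - h (v + t *\<^sub>R (w - v))"])
    have "(h has_derivative (\<lambda>d. grad h v \<bullet> d)) (at (v + 0 *\<^sub>R (w - v)))"
      using grad_has_derivative[OF diff] by simp
    then have "((\<lambda>t. h (v + t *\<^sub>R (w - v))) has_derivative
        (\<lambda>t. grad h v \<bullet> (t *\<^sub>R (w - v)))) (at 0)"
      by (rule has_derivative_compose[rotated]) (auto intro!: derivative_eq_intros)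
    then show "((\<lambda>t. - h (v + t *\<^sub>R (w - v))) has_real_derivative - (grad h v \<bullet> (w - v))) (at 0)"
      unfolding has_field_derivative_def
      by (auto intro!: derivative_eq_intros simp: fun_eq_iff)
  next
    fix e :: real assume e: "0 < e"
    have "eventually (\<lambda>t. t \<in> {0<..<1::real}) (at_right 0)"
      by (rule eventually_at_rightI[of 0 1]) auto
    then show "eventually (\<lambda>t. - h (v + 0 *\<^sub>R (w - v)) + h v - e * t
        \<le> - h (v + t *\<^sub>R (w - v)) + (1 - t) * h v + t * h w) (at_right 0)"
    proof eventually_elim
      case (elim t)
      have "h ((1 - t) *\<^sub>R v + t *\<^sub>R w) \<le> (1 - t) * h v + t * h w"
        using convex_onD[OF cvx, of t v w] elim by auto
      moreover have "(1 - t) *\<^sub>R v + t *\<^sub>R w = v + t *\<^sub>R (w - v)" by (simp add: algebra_simps)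
      moreover have "0 \<le> e * t" using e elim by simp
      ultimately show ?case by simp
    qed
  qed
  then show ?thesis by simp
qed

text \<open>The set \<open>C\<close> may be nonconvex: only the piece of the segment up to t must
  lie in it, which is what is known while an exit from the level set is still to be
  excluded.\<close>

lemma segment_taylor_bound:
  fixes k :: "'a::real_inner \<Rightarrow> real"
  assumes der: "\<And>y. y \<in> C \<Longrightarrow> (k has_derivative (\<lambda>e. G y \<bullet> e)) (at y)"
    and lip: "L-lipschitz_on C G" and t: "0 \<le> t"
    and seg: "\<And>\<tau>. 0 \<le> \<tau> \<Longrightarrow> \<tau> \<le> t \<Longrightarrow> x + \<tau> *\<^sub>R d \<in> C"
  shows "\<bar>k (x + t *\<^sub>R d) - k x - t * (G x \<bullet> d)\<bar> \<le> L * (norm d)\<^sup>2 / 2 * t\<^sup>2"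
proof -
  have "\<bar>k (x + t *\<^sub>R d) - k (x + 0 *\<^sub>R d) - t * (G (x + 0 *\<^sub>R d) \<bullet> d)\<bar> \<le> L * (norm d)\<^sup>2 / 2 * t\<^sup>2"
  proof (rule taylor_remainder_bound[OF t])
    fix \<tau> assume \<tau>: "0 \<le> \<tau>" "\<tau> \<le> t"
    have "((\<lambda>t. k (x + t *\<^sub>R d)) has_derivative (\<lambda>t. G (x + \<tau> *\<^sub>R d) \<bullet> (t *\<^sub>R d))) (at \<tau>)"
      using der[OF seg[OF \<tau>]] by (rule has_derivative_compose[rotated]) (auto intro!: derivative_eq_intros)
    then show "((\<lambda>t. k (x + t *\<^sub>R d)) has_real_derivative G (x + \<tau> *\<^sub>R d) \<bullet> d) (at \<tau>)"
      unfolding has_field_derivative_def by (simp add: mult_commute_abs)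
    have "\<bar>(G (x + \<tau> *\<^sub>R d) - G x) \<bullet> d\<bar> \<le> norm (G (x + \<tau> *\<^sub>R d) - G x) * norm d"
      by (rule Cauchy_Schwarz_ineq2)
    also have "\<dots> \<le> (L * (\<tau> * norm d)) * norm d"
      using lipschitz_onD[OF lip seg[OF \<tau>] seg[of 0]] t \<tau>
      by (intro mult_right_mono) (auto simp: dist_norm)
    finally show "\<bar>G (x + \<tau> *\<^sub>R d) \<bullet> d - G (x + 0 *\<^sub>R d) \<bullet> d\<bar> \<le> L * (norm d)\<^sup>2 * \<tau>"
      by (simp add: inner_diff_left power2_eq_square algebra_simps)
  qed
  then show ?thesis by simp
qed

section \<open>Discrete random variables and independence\<close>

lemma measurable_count_space_countable_range:
  assumes "countable (X ` space N)" and "\<And>a. X -` {a} \<inter> space N \<in> sets N"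
  shows "X \<in> measurable N (count_space UNIV)"
proof (rule measurableI)
  fix A
  have "X -` A \<inter> space N = (\<Union>a\<in>X ` space N \<inter> A. X -` {a} \<inter> space N)" by auto
  also have "\<dots> \<in> sets N"
    using assms by (intro sets.countable_UN'') (auto intro: countable_subset)
  finally show "X -` A \<inter> space N \<in> sets N" .
qed simp

text \<open>On the sub-sigma-algebra \<open>N\<close>, the measure restricted to \<open>E\<close>
  and q times the measure coincide; a function measurable with respect to \<open>N\<close> therefore
  has the same integral under both.\<close>

lemma (in prob_space) integral_over_independent_event:
  fixes Z :: "'a \<Rightarrow> real"
  assumes sub: "subalgebra M N" and E: "E \<in> events" and q: "0 \<le> q"
    and indep: "\<And>A. A \<in> sets N \<Longrightarrow> prob (A \<inter> E) = prob A * q"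
    and Z: "Z \<in> borel_measurable N"
  shows "(\<integral>\<omega>. indicator E \<omega> * Z \<omega> \<partial>M) = q * (\<integral>\<omega>. Z \<omega> \<partial>M)"
proof -
  have id: "(\<lambda>\<omega>. \<omega>) \<in> measurable M N"
    using sub by (auto intro!: measurableI simp: subalgebra_def dest: sets.sets_into_space)
  have ZM: "Z \<in> borel_measurable M" using measurable_compose[OF id Z] by simp
  define D1 where "D1 = distr (density M (indicator E)) N (\<lambda>\<omega>. \<omega>)"
  define D2 where "D2 = distr (density M (\<lambda>_. ennreal q)) N (\<lambda>\<omega>. \<omega>)"
  have "D1 = D2"
  proof (rule measure_eqI)
    fix A assume "A \<in> sets D1"
    then have A: "A \<in> sets N" by (simp add: D1_def)
    then have AM: "A \<in> events" and Asp: "A \<inter> space M = A"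
      using sub sets.sets_into_space[OF A] by (auto simp: subalgebra_def)
    have "emeasure D1 A = emeasure (density M (indicator E)) A"
      using A id Asp by (simp add: D1_def emeasure_distr)
    also have "\<dots> = emeasure M (A \<inter> E)"
      using emeasure_restricted[OF E AM] by (simp add: Int_commute)
    also have "\<dots> = ennreal (prob A * q)" using indep[OF A] by (simp add: emeasure_eq_measure)
    also have "\<dots> = ennreal q * emeasure M A"
      using q by (simp add: emeasure_eq_measure ennreal_mult'' mult.commute)
    also have "\<dots> = emeasure (density M (\<lambda>_. ennreal q)) A"
      using AM by (simp add: emeasure_density_const)
    also have "\<dots> = emeasure D2 A" using A id Asp by (simp add: D2_def emeasure_distr)
    finally show "emeasure D1 A = emeasure D2 A" .
  qed (simp add: D1_def D2_def)
  moreover have "(\<integral>\<omega>. Z \<omega> \<partial>D1) = (\<integral>\<omega>. indicator E \<omega> * Z \<omega> \<partial>M)"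
  proof -
    have "(\<integral>\<omega>. Z \<omega> \<partial>D1) = (\<integral>\<omega>. Z \<omega> \<partial>density M (\<lambda>\<omega>. ennreal (indicator E \<omega>)))"
      using id Z by (simp add: D1_def integral_distr ennreal_indicator)
    also have "\<dots> = (\<integral>\<omega>. indicator E \<omega> *\<^sub>R Z \<omega> \<partial>M)" using ZM E by (intro integral_density) auto
    finally show ?thesis by simp
  qed
  moreover have "(\<integral>\<omega>. Z \<omega> \<partial>D2) = q * (\<integral>\<omega>. Z \<omega> \<partial>M)"
  proof -
    have "(\<integral>\<omega>. Z \<omega> \<partial>D2) = (\<integral>\<omega>. Z \<omega> \<partial>density M (\<lambda>\<omega>. ennreal q))"
      using id Z by (simp add: D2_def integral_distr)
    also have "\<dots> = (\<integral>\<omega>. q *\<^sub>R Z \<omega> \<partial>M)" using ZM q by (intro integral_density) auto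
    finally show ?thesis by simp
  qed
  ultimately show ?thesis by simp
qed

section \<open>Blocks\<close>

lemma block_part_nth: "block_part blk i v $ j = (if blk j = i then v $ j else 0)"
  by (simp add: block_part_def)

lemma block_part_mem [simp]: "block_part blk i v \<in> block_space blk i"
  by (simp add: block_part_def block_space_def)

lemma block_part_ident: "v \<in> block_space blk i \<Longrightarrow> block_part blk i v = v"
  by (auto simp: block_part_def block_space_def vec_eq_iff)

lemma block_part_other: "v \<in> block_space blk i \<Longrightarrow> l \<noteq> i \<Longrightarrow> block_part blk l v = 0"
  by (auto simp: block_part_def block_space_def vec_eq_iff)

lemma linear_block_part: "linear (block_part blk i)"
  by (rule linearI) (auto simp: block_part_def vec_eq_iff)

lemmas block_part_simps =
  linear_add[OF linear_block_part] linear_diff[OF linear_block_part]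
  linear_scale[OF linear_block_part] linear_0[OF linear_block_part]
  linear_sum[OF linear_block_part]

lemma subspace_block_space: "subspace (block_space blk i)"
  by (auto simp: subspace_def block_space_def)

lemma block_part_inner: "block_part blk i v \<bullet> w = v \<bullet> block_part blk i w"
  by (auto simp: inner_vec_def block_part_def intro!: sum.cong)

lemma inner_block_part: "block_part blk i v \<bullet> block_part blk i w = block_part blk i v \<bullet> w"
  by (auto simp: inner_vec_def block_part_def intro!: sum.cong)

lemma block_part_inner_block: "w \<in> block_space blk i \<Longrightarrow> block_part blk i v \<bullet> w = v \<bullet> w"
  by (simp add: block_part_inner block_part_ident)

lemma norm_block_part_le: "norm (block_part blk i v) \<le> norm v"
proof -
  have "norm (block_part blk i v) * norm (block_part blk i v) = block_part blk i v \<bullet> v"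
    by (metis inner_block_part norm_eq_sqrt_inner real_sqrt_mult_self abs_of_nonneg inner_ge_zero)
  also have "\<dots> \<le> norm (block_part blk i v) * norm v" by (rule norm_cauchy_schwarz)
  finally show ?thesis by (cases "norm (block_part blk i v) = 0") auto
qed

lemma sum_block_part:
  fixes blk :: "'n::finite \<Rightarrow> 'b::finite"
  shows "(\<Sum>i\<in>UNIV. block_part blk i v) = v"
  by (simp add: vec_eq_iff block_part_nth)

lemma block_part_eqI:
  fixes blk :: "'n::finite \<Rightarrow> 'b::finite"
  assumes "\<And>i. block_part blk i v = block_part blk i w"
  shows "v = w"
  by (metis (no_types, lifting) assms sum.cong sum_block_part)

lemma norm_le_sum_block_part:
  fixes blk :: "'n::finite \<Rightarrow> 'b::finite"
  shows "norm v \<le> (\<Sum>i\<in>UNIV. norm (block_part blk i v))"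
  by (metis sum_block_part norm_sum)

lemma lipschitz_on_from_blocks:
  fixes blk :: "'n::finite \<Rightarrow> 'b::finite"
  assumes "\<And>i. \<exists>L. L-lipschitz_on C (\<lambda>y. block_part blk i (G y))"
  shows "\<exists>L. L-lipschitz_on C G"
proof -
  obtain L where L: "\<And>i. (L i)-lipschitz_on C (\<lambda>y. block_part blk i (G y))"
    using assms by metis
  have "(\<Sum>i\<in>UNIV. L i)-lipschitz_on C G"
  proof (rule lipschitz_onI)
    fix y z assume yz: "y \<in> C" "z \<in> C"
    have "dist (G y) (G z) \<le> (\<Sum>i\<in>UNIV. norm (block_part blk i (G y - G z)))"
      unfolding dist_norm by (rule norm_le_sum_block_part)
    also have "\<dots> \<le> (\<Sum>i\<in>UNIV. L i * dist y z)"
      using lipschitz_onD[OF L yz] by (intro sum_mono) (simp add: dist_norm block_part_simps)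
    finally show "dist (G y) (G z) \<le> (\<Sum>i\<in>UNIV. L i) * dist y z" by (simp add: sum_distrib_right)
  qed (use L lipschitz_on_nonneg in \<open>blast intro: sum_nonneg\<close>)
  then show ?thesis ..
qed

section \<open>The objective and its trial points\<close>

locale composite_problem =
  fixes blk :: "'n::finite \<Rightarrow> 'b::finite"
    and f :: "real ^ 'n \<Rightarrow> real"
    and F :: "real ^ 'n \<Rightarrow> real ^ 'm::finite"
    and h :: "real ^ 'm \<Rightarrow> real"
    and g :: "'b \<Rightarrow> real ^ 'n \<Rightarrow> ereal"
    and x\<^sub>0 :: "real ^ 'n"
  assumes f_diff: "y \<in> edom (objective blk f F h g) \<Longrightarrow> f differentiable (at y)"
    and F_diff: "y \<in> edom (objective blk f F h g) \<Longrightarrow> F differentiable (at y)"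
    and x0_dom: "x\<^sub>0 \<in> edom (objective blk f F h g)"
    and level_compact:
      "compact {y. objective blk f F h g y \<le> objective blk f F h g x\<^sub>0}"
    and assm_A: "assumption_A blk f F h g {y. objective blk f F h g y \<le> objective blk f F h g x\<^sub>0}"
begin

definition \<phi> :: "real ^ 'n \<Rightarrow> ereal" where "\<phi> = objective blk f F h g"

abbreviation "C \<equiv> {y. \<phi> y \<le> \<phi> x\<^sub>0}"
abbreviation "bp \<equiv> block_part blk"
abbreviation "V \<equiv> block_space blk"

definition gF :: "'m \<Rightarrow> real ^ 'n \<Rightarrow> real ^ 'n" where "gF j = grad (\<lambda>z. F z $ j)"

definition S :: "real ^ 'n \<Rightarrow> real" where "S y = f y + h (F y)"

definition gS :: "real ^ 'n \<Rightarrow> real ^ 'n" where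
  "gS y = grad f y + (\<Sum>j\<in>UNIV. (grad h (F y) $ j) *\<^sub>R gF j y)"

text \<open>\<open>real_of_ereal\<close> sends infinity to 0, so this is meaningful only where g_i
  is finite, in particular on \<open>edom \<phi>\<close>.\<close>

definition gr :: "'b \<Rightarrow> real ^ 'n \<Rightarrow> real" where "gr i y = real_of_ereal (g i (bp i y))"

definition gsum :: "real ^ 'n \<Rightarrow> real" where "gsum y = (\<Sum>i\<in>UNIV. gr i y)"

lemma h_convex: "convex_on UNIV h" and h_diff: "h differentiable (at v)"
  and grad_h_lipschitz: "\<exists>L. L-lipschitz_on UNIV (grad h)"
  and g_proper: "proper_on (V i) (g i)"
  and g_convex: "ereal_convex_on (V i) (g i)"
  using assm_A by (auto simp: assumption_A_def)

lemma g_not_MInf: "z \<in> V i \<Longrightarrow> g i z \<noteq> -\<infinity>"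
  using g_proper[of i] by (auto simp: proper_on_def)

lemma edom_iff: "y \<in> edom \<phi> \<longleftrightarrow> (\<forall>i. g i (bp i y) \<noteq> \<infinity>)"
proof -
  have "block_sum blk g y = \<infinity> \<longleftrightarrow> (\<exists>i. g i (bp i y) = \<infinity>)"
    unfolding block_sum_def by (auto simp: sum_Pinfty)
  then show ?thesis by (auto simp: edom_def \<phi>_def objective_def)
qed

lemma g_eq_gr: "y \<in> edom \<phi> \<Longrightarrow> g i (bp i y) = ereal (gr i y)"
  using g_not_MInf[of "bp i y" i] by (cases "g i (bp i y)") (auto simp: edom_iff gr_def)

lemma phi_eq: "y \<in> edom \<phi> \<Longrightarrow> \<phi> y = ereal (S y + gsum y)"
  by (simp add: \<phi>_def objective_def block_sum_def S_def gsum_def g_eq_gr)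

lemma phi_outside: "y \<notin> edom \<phi> \<Longrightarrow> \<phi> y = \<infinity>"
  by (simp add: edom_def)

lemma x0_dom': "x\<^sub>0 \<in> edom \<phi>"
  using x0_dom by (simp add: \<phi>_def)

lemma level_dom: "y \<in> C \<Longrightarrow> y \<in> edom \<phi>"
  using x0_dom' by (auto simp: edom_def)

lemma level_compact': "compact C"
  using level_compact by (simp add: \<phi>_def)

lemma phi_bounded_below: "\<exists>lo. \<forall>y\<in>C. ereal lo \<le> \<phi> y"
proof -
  obtain fl hl gl where b: "\<forall>x\<in>C. fl \<le> f x \<and> ereal gl \<le> block_sum blk g x" "\<forall>v. hl \<le> h v"
    using assm_A by (auto simp: assumption_A_def \<phi>_def)
  have "ereal (fl + hl + gl) \<le> \<phi> y" if "y \<in> C" for y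
  proof -
    have "ereal (fl + hl) + ereal gl \<le> ereal (f y + h (F y)) + block_sum blk g y"
      using b that by (intro add_mono) (auto intro: add_mono)
    then show ?thesis by (simp add: \<phi>_def objective_def)
  qed
  then show ?thesis by blast
qed

lemma f_deriv: "y \<in> edom \<phi> \<Longrightarrow> (f has_derivative (\<lambda>d. grad f y \<bullet> d)) (at y)"
  using f_diff by (simp add: \<phi>_def grad_has_derivative)

lemma F_deriv: "y \<in> edom \<phi> \<Longrightarrow> ((\<lambda>z. F z $ j) has_derivative (\<lambda>d. gF j y \<bullet> d)) (at y)"
  unfolding gF_def
  by (rule grad_has_derivative)
    (use F_diff bounded_linear.has_derivative[OF bounded_linear_vec_nth]
      in \<open>fastforce simp: \<phi>_def differentiable_def\<close>)

lemma F_deriv_vec: "y \<in> edom \<phi> \<Longrightarrow> (F has_derivative (\<lambda>d. \<chi> j. gF j y \<bullet> d)) (at y)"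
  using F_deriv by (subst has_derivative_componentwise_within) (auto simp: Basis_vec_def inner_axis)

lemma h_deriv: "(h has_derivative (\<lambda>d. grad h v \<bullet> d)) (at v)"
  using grad_has_derivative[OF h_diff] .

lemma S_deriv:
  assumes "y \<in> edom \<phi>" shows "(S has_derivative (\<lambda>d. gS y \<bullet> d)) (at y)"
proof -
  have "((\<lambda>z. h (F z)) has_derivative (\<lambda>d. grad h (F y) \<bullet> (\<chi> j. gF j y \<bullet> d))) (at y)"
    by (rule has_derivative_compose[OF F_deriv_vec[OF assms] h_deriv])
  then have "(S has_derivative (\<lambda>d. grad f y \<bullet> d + grad h (F y) \<bullet> (\<chi> j. gF j y \<bullet> d))) (at y)"
    unfolding S_def[abs_def] by (intro has_derivative_add f_deriv assms)
  moreover have "grad h (F y) \<bullet> (\<chi> j. gF j y \<bullet> d) = (\<Sum>j\<in>UNIV. (grad h (F y) $ j) *\<^sub>R gF j y) \<bullet> d" for d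
    by (simp add: inner_vec_def[of "grad h (F y)"] inner_sum_left)
  ultimately show ?thesis by (simp add: gS_def inner_add_left)
qed

lemma grad_f_lipschitz: "\<exists>L. L-lipschitz_on C (grad f)"
  by (rule lipschitz_on_from_blocks[where blk = blk])
    (use assm_A in \<open>auto simp: assumption_A_def block_grad_def \<phi>_def\<close>)

lemma gF_lipschitz: "\<exists>L. L-lipschitz_on C (gF j)"
  unfolding gF_def by (rule lipschitz_on_from_blocks[where blk = blk])
    (use assm_A in \<open>auto simp: assumption_A_def block_grad_def \<phi>_def\<close>)

lemma continuous_F: "continuous_on C F"
  by (rule differentiable_imp_continuous_on, rule differentiable_at_imp_differentiable_on)
    (use F_diff level_dom in \<open>auto simp: \<phi>_def\<close>)

lemma continuous_grad_h: "continuous_on UNIV (grad h)"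
  using grad_h_lipschitz lipschitz_on_continuous_on by blast

lemma continuous_grad_f: "continuous_on C (grad f)"
  using grad_f_lipschitz lipschitz_on_continuous_on by blast

lemma continuous_gF: "continuous_on C (gF j)"
  using gF_lipschitz lipschitz_on_continuous_on by blast

lemma continuous_gS: "continuous_on C gS"
  unfolding gS_def[abs_def]
  by (intro continuous_intros continuous_grad_f continuous_gF
      continuous_on_compose2[OF continuous_grad_h continuous_F]) auto

lemma bounded_on_level:
  assumes "continuous_on C \<psi>"
  shows "\<exists>B>0. \<forall>y\<in>C. norm (\<psi> y :: 'z::real_normed_vector) \<le> B"
  using compact_imp_bounded[OF compact_continuous_image[OF assms level_compact']]
  by (auto simp: bounded_pos)

lemma segment_dom:
  assumes y: "y \<in> edom \<phi>" and z: "z \<in> edom \<phi>" and t: "0 \<le> t" "t \<le> 1"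
  shows "y + t *\<^sub>R (z - y) \<in> edom \<phi>"
    and "gsum (y + t *\<^sub>R (z - y)) \<le> (1 - t) * gsum y + t * gsum z"
proof -
  let ?w = "y + t *\<^sub>R (z - y)"
  have le: "g i (bp i ?w) \<le> ereal ((1 - t) * gr i y + t * gr i z)" for i
  proof -
    \<comment> \<open>\<open>ereal_convex_on\<close> covers 0 < t < 1; the endpoints are checked
      directly.\<close>
    consider "t = 0" | "t = 1" | "0 < t" "t < 1" using t by linarith
    then show ?thesis
    proof cases
      case 3
      have "bp i ?w = (1 - t) *\<^sub>R bp i y + t *\<^sub>R bp i z"
        by (simp add: block_part_simps algebra_simps)
      then show ?thesis
        using g_convex[of i] 3 y z unfolding ereal_convex_on_def
        by (metis (no_types, lifting) block_part_mem g_eq_gr times_ereal.simps(1) plus_ereal.simps(1))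
    qed (use y z g_eq_gr in auto)
  qed
  then show w: "?w \<in> edom \<phi>" unfolding edom_iff by (metis ereal_infty_less_eq(1) PInfty_neq_ereal(1))
  have "gr i ?w \<le> (1 - t) * gr i y + t * gr i z" for i
    using le[of i] w by (simp add: g_eq_gr)
  then have "gsum ?w \<le> (\<Sum>i\<in>UNIV. (1 - t) * gr i y + t * gr i z)"
    unfolding gsum_def by (rule sum_mono)
  then show "gsum ?w \<le> (1 - t) * gsum y + t * gsum z"
    by (simp add: gsum_def sum.distrib sum_distrib_left)
qed

section \<open>First-order optimality of trial points\<close>

definition J :: "real ^ 'n \<Rightarrow> real ^ 'n \<Rightarrow> real ^ 'm" where "J y d = (\<chi> j. gF j y \<bullet> d)"

text \<open>Subgradients of g_i in the sense of convex analysis. The vector \<open>v\<close> lives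
  in the full space but is tested on block \<open>i\<close> only, so full gradients may be inserted
  without projecting them.\<close>

definition subgrad :: "'b \<Rightarrow> real ^ 'n \<Rightarrow> real ^ 'n \<Rightarrow> bool" where
  "subgrad i y v \<longleftrightarrow> (\<forall>z\<in>V i. g i (bp i y) + ereal (v \<bullet> (z - bp i y)) \<le> g i z)"

lemma subgradD:
  assumes "subgrad i y v" "y \<in> edom \<phi>" "z \<in> edom \<phi>"
  shows "gr i y + v \<bullet> (bp i z - bp i y) \<le> gr i z"
proof -
  have "g i (bp i y) + ereal (v \<bullet> (bp i z - bp i y)) \<le> g i (bp i z)"
    using assms(1) by (simp add: subgrad_def)
  then show ?thesis by (simp add: g_eq_gr assms)
qed

text \<open>The gradient, at displacement \<open>d\<close>, of the smooth part of the block model,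
  taken in all coordinates. At d = 0 it equals \<open>gS x\<close>.\<close>

definition model_grad :: "real ^ 'n \<Rightarrow> real \<Rightarrow> real ^ 'n \<Rightarrow> real ^ 'n" where
  "model_grad x \<beta> d =
     grad f x + (\<Sum>j\<in>UNIV. (grad h (F x + J x d) $ j) *\<^sub>R gF j x) + \<beta> *\<^sub>R d"

lemma linear_J: "linear (J x)"
  by (rule linearI) (auto simp: J_def inner_add_right vec_eq_iff)

lemma sum_gF_inner: "(\<Sum>j\<in>UNIV. (c $ j) *\<^sub>R gF j x) \<bullet> d = c \<bullet> J x d"
  by (simp add: inner_vec_def[of c] inner_sum_left J_def)

lemma gS_inner: "gS x \<bullet> d = grad f x \<bullet> d + grad h (F x) \<bullet> J x d"
  by (simp add: gS_def inner_add_left sum_gF_inner)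

text \<open>The displacement lies in block \<open>i\<close>, where the truncated gradient and
  Jacobian act like the full ones.\<close>

lemma block_model_eq:
  assumes "z \<in> V i"
  shows "block_model blk f F h g i x \<beta> z = g i z +
    ereal (grad f x \<bullet> (z - bp i x) + h (F x + J x (z - bp i x)) + \<beta> / 2 * (norm (z - bp i x))\<^sup>2)"
proof -
  have d: "z - bp i x \<in> V i" using assms by (intro subspace_diff[OF subspace_block_space]) auto
  have "block_jac blk i F x *v (z - bp i x) = J x (z - bp i x)"
    using d by (simp add: vec_eq_iff block_jac_def matrix_vector_mul_component J_def block_grad_def
        gF_def block_part_inner_block)
  then show ?thesis
    using d unfolding block_model_def block_grad_def
    by (cases "g i z") (auto simp: block_part_inner_block)
qed

lemma trial_point_diff:
  assumes "trial_point blk f F h g i x \<beta> y"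
  shows "y - x \<in> V i" "bp i y - bp i x = y - x" "l \<noteq> i \<Longrightarrow> bp l y = bp l x"
proof -
  show *: "l \<noteq> i \<Longrightarrow> bp l y = bp l x" for l using assms by (simp add: trial_point_def)
  have "bp l (y - x) = bp l (bp i (y - x))" for l
    using * by (cases "l = i") (auto simp: block_part_ident block_part_other[OF block_part_mem] block_part_simps)
  then have "y - x = bp i (y - x)" by (rule block_part_eqI)
  then show "y - x \<in> V i" "bp i y - bp i x = y - x"
    by (metis block_part_mem, simp add: block_part_simps)
qed

lemma trial_point_minimal:
  assumes "trial_point blk f F h g i x \<beta> y" and "z \<in> V i"
  shows "block_model blk f F h g i x \<beta> (bp i y) \<le> block_model blk f F h g i x \<beta> z"
  using assms by (auto simp: trial_point_def is_arg_min_def not_less)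

lemma trial_point_dom:
  assumes x: "x \<in> edom \<phi>" and y: "trial_point blk f F h g i x \<beta> y"
  shows "y \<in> edom \<phi>"
  unfolding edom_iff
proof
  fix l
  show "g l (bp l y) \<noteq> \<infinity>"
  proof (cases "l = i")
    case True
    have "block_model blk f F h g i x \<beta> (bp i y) \<le> block_model blk f F h g i x \<beta> (bp i x)"
      using y by (rule trial_point_minimal) simp
    then show ?thesis
      using x True g_eq_gr[OF x, of i] by (auto simp: block_model_eq edom_iff)
  qed (use x trial_point_diff(3)[OF y] edom_iff in auto)
qed

text \<open>The model is smooth apart from the convex \<open>g i\<close>. Comparing the minimizer
  with points of the segment towards \<open>z\<close>, and letting them approach it, leaves the
  slope of the smooth part.\<close>

lemma trial_point_subgrad:
  assumes x: "x \<in> edom \<phi>" and y: "trial_point blk f F h g i x \<beta> y"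
  shows "subgrad i y (- model_grad x \<beta> (y - x))"
  unfolding subgrad_def
proof
  fix z assume z: "z \<in> V i"
  let ?s = "bp i y" and ?e = "model_grad x \<beta> (y - x)"
  note yd = trial_point_dom[OF x y]
  define q where "q = (\<lambda>w. grad f x \<bullet> (w - bp i x) + h (F x + J x (w - bp i x))
    + \<beta> / 2 * (norm (w - bp i x))\<^sup>2)"
  show "g i ?s + ereal (- ?e \<bullet> (z - ?s)) \<le> g i z"
  proof (cases "g i z = \<infinity>")
    case False
    then obtain c where c: "g i z = ereal c"
      using g_not_MInf[OF z] by (cases "g i z") auto
    have "gr i y \<le> c + ?e \<bullet> (z - ?s)"
    proof (rule directional_first_order_condition[where q = "\<lambda>t. q (?s + t *\<^sub>R (z - ?s))"])
      have shift: "((\<lambda>w. w - bp i x) has_derivative (\<lambda>e. e)) (at ?s)"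
        by (auto intro!: derivative_eq_intros)
      have "((\<lambda>d. h (F x + J x d)) has_derivative
          (\<lambda>e. grad h (F x + J x (y - x)) \<bullet> J x e)) (at (y - x))"
        using linear_imp_has_derivative[OF linear_J, of x "at (y - x)"]
        by (intro has_derivative_compose[OF _ h_deriv] derivative_eq_intros) auto
      then have "((\<lambda>w. h (F x + J x (w - bp i x))) has_derivative
          (\<lambda>e. grad h (F x + J x (y - x)) \<bullet> J x e)) (at ?s)"
        using has_derivative_compose[OF shift, where g = "\<lambda>d. h (F x + J x d)"]
        by (simp add: trial_point_diff(2)[OF y])
      moreover have "((\<lambda>w. (norm (w - bp i x))\<^sup>2) has_derivative (\<lambda>e. 2 * ((y - x) \<bullet> e))) (at ?s)"
        unfolding power2_norm_eq_inner using trial_point_diff(2)[OF y]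
        by (auto intro!: derivative_eq_intros simp: inner_commute)
      ultimately have "(q has_derivative (\<lambda>e. grad f x \<bullet> e + grad h (F x + J x (y - x)) \<bullet> J x e
          + \<beta> / 2 * (2 * ((y - x) \<bullet> e)))) (at ?s)"
        unfolding q_def by (intro has_derivative_add has_derivative_mult_right)
          (auto intro!: derivative_eq_intros)
      moreover have "grad f x \<bullet> e + grad h (F x + J x (y - x)) \<bullet> J x e + \<beta> / 2 * (2 * ((y - x) \<bullet> e))
          = ?e \<bullet> e" for e
        by (simp add: model_grad_def inner_add_left sum_gF_inner)
      ultimately have "(q has_derivative (\<lambda>e. ?e \<bullet> e)) (at (?s + 0 *\<^sub>R (z - ?s)))" by simp
      then have "((\<lambda>t. q (?s + t *\<^sub>R (z - ?s))) has_derivative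
          (\<lambda>t. ?e \<bullet> (t *\<^sub>R (z - ?s)))) (at 0)"
        by (rule has_derivative_compose[rotated]) (auto intro!: derivative_eq_intros)
      then show "((\<lambda>t. q (?s + t *\<^sub>R (z - ?s))) has_real_derivative ?e \<bullet> (z - ?s)) (at 0)"
        unfolding has_field_derivative_def by (simp add: mult_commute_abs)
    next
      fix e :: real assume e: "0 < e"
      have "eventually (\<lambda>t. t \<in> {0<..<1::real}) (at_right 0)"
        by (rule eventually_at_rightI[of 0 1]) auto
      then show "eventually (\<lambda>t. q (?s + 0 *\<^sub>R (z - ?s)) + gr i y - e * t
          \<le> q (?s + t *\<^sub>R (z - ?s)) + (1 - t) * gr i y + t * c) (at_right 0)"
      proof eventually_elim
        case (elim t)
        let ?w = "?s + t *\<^sub>R (z - ?s)"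
        have weq: "?w = (1 - t) *\<^sub>R ?s + t *\<^sub>R z" by (simp add: algebra_simps)
        have w: "?w \<in> V i"
          using z by (intro subspace_add[OF subspace_block_space] subspace_scale[OF subspace_block_space]
              subspace_diff[OF subspace_block_space]) auto
        have "g i ?w \<le> ereal ((1 - t) * gr i y + t * c)"
          using g_convex[of i] elim z c g_eq_gr[OF yd, of i] unfolding ereal_convex_on_def weq
          by (metis (no_types, lifting) block_part_mem greaterThanLessThan_iff
              times_ereal.simps(1) plus_ereal.simps(1))
        moreover have "g i ?s + ereal (q ?s) \<le> g i ?w + ereal (q ?w)"
          using trial_point_minimal[OF y w] by (simp add: block_model_eq w q_def)
        ultimately have "gr i y + q ?s \<le> (1 - t) * gr i y + t * c + q ?w"
          using g_eq_gr[OF yd, of i] by (cases "g i ?w") auto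
        moreover have "0 \<le> e * t" using e elim by simp
        ultimately show ?case by simp
      qed
    qed
    then show ?thesis by (simp add: c g_eq_gr[OF yd])
  qed simp
qed

text \<open>Adding the two optimality inequalities cancels g_i; the gradient of h is monotone, and
  the proximal term leaves \<beta> |z - y|^2 \<le> 0. Uniqueness makes the line search
  deterministic.\<close>

lemma trial_point_unique:
  assumes x: "x \<in> edom \<phi>" and \<beta>: "0 < \<beta>"
    and y: "trial_point blk f F h g i x \<beta> y" and z: "trial_point blk f F h g i x \<beta> z"
  shows "y = z"
proof -
  let ?u = "F x + J x (y - x)" and ?w = "F x + J x (z - x)"
  note yd = trial_point_dom[OF x y] and zd = trial_point_dom[OF x z]
  have yz: "bp i z - bp i y = z - y"
    using arg_cong2[OF trial_point_diff(2)[OF z] trial_point_diff(2)[OF y], of minus] by simp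
  have "gr i y + - model_grad x \<beta> (y - x) \<bullet> (z - y) \<le> gr i z"
    using subgradD[OF trial_point_subgrad[OF x y] yd zd] by (simp add: yz)
  moreover have "gr i z + - model_grad x \<beta> (z - x) \<bullet> (y - z) \<le> gr i y"
    using subgradD[OF trial_point_subgrad[OF x z] zd yd] yz by (metis minus_diff_eq)
  ultimately have "(model_grad x \<beta> (z - x) - model_grad x \<beta> (y - x)) \<bullet> (z - y) \<le> 0"
    by (simp add: inner_diff_left inner_diff_right)
  moreover have "(model_grad x \<beta> (z - x) - model_grad x \<beta> (y - x)) \<bullet> (z - y)
      = (grad h ?w - grad h ?u) \<bullet> J x (z - y) + \<beta> * (norm (z - y))\<^sup>2"
  proof -
    have "model_grad x \<beta> (z - x) - model_grad x \<beta> (y - x)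
        = (\<Sum>j\<in>UNIV. ((grad h ?w - grad h ?u) $ j) *\<^sub>R gF j x) + \<beta> *\<^sub>R (z - y)"
      by (simp add: model_grad_def sum_subtractf algebra_simps)
    then show ?thesis by (simp only: inner_add_left sum_gF_inner) (simp add: power2_norm_eq_inner)
  qed
  moreover have "0 \<le> (grad h ?w - grad h ?u) \<bullet> J x (z - y)"
  proof -
    have "J x (z - y) = ?w - ?u" by (simp add: linear_diff[OF linear_J])
    moreover have "h ?u + grad h ?u \<bullet> (?w - ?u) \<le> h ?w" "h ?w + grad h ?w \<bullet> (?u - ?w) \<le> h ?u"
      by (rule convex_on_above_gradient[OF h_convex h_diff])+
    ultimately show ?thesis by (simp add: inner_diff_left inner_diff_right)
  qed
  ultimately have "\<beta> * (norm (z - y))\<^sup>2 \<le> 0" by linarith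
  then show ?thesis using \<beta> by (simp add: mult_le_0_iff)
qed

text \<open>The subgradient at the trial point is tested at \<open>x\<close>. This yields the full
  \<beta> |y - x|^2, whereas comparing model values would give half of it; the second half later
  absorbs the Taylor error.\<close>

lemma trial_point_decrease:
  assumes x: "x \<in> edom \<phi>" and y: "trial_point blk f F h g i x \<beta> y"
  shows "gsum y - gsum x
    \<le> - (grad f x \<bullet> (y - x)) + h (F x) - h (F x + J x (y - x)) - \<beta> * (norm (y - x))\<^sup>2"
proof -
  let ?w = "F x + J x (y - x)"
  note yd = trial_point_dom[OF x y]
  have "bp i x - bp i y = - (y - x)" using trial_point_diff(2)[OF y] by (metis minus_diff_eq)
  then have "gr i y + model_grad x \<beta> (y - x) \<bullet> (y - x) \<le> gr i x"
    using subgradD[OF trial_point_subgrad[OF x y] yd x] by (simp add: inner_diff_right)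
  moreover have "gsum y - gsum x = gr i y - gr i x"
  proof -
    have "gsum y - gsum x = (\<Sum>l\<in>UNIV. gr l y - gr l x)" by (simp add: gsum_def sum_subtractf)
    also have "\<dots> = (\<Sum>l\<in>UNIV. if l = i then gr l y - gr l x else 0)"
      using trial_point_diff(3)[OF y] by (intro sum.cong) (auto simp: gr_def)
    finally show ?thesis by simp
  qed
  moreover have "h ?w + grad h ?w \<bullet> (F x - ?w) \<le> h (F x)"
    by (rule convex_on_above_gradient[OF h_convex h_diff])
  moreover have "model_grad x \<beta> (y - x) \<bullet> (y - x)
      = grad f x \<bullet> (y - x) + grad h ?w \<bullet> J x (y - x) + \<beta> * (norm (y - x))\<^sup>2"
    unfolding model_grad_def inner_add_left sum_gF_inner by (simp add: power2_norm_eq_inner)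
  ultimately show ?thesis by simp
qed

text \<open>The level set need not be convex, so the gradients are a priori not Lipschitz between \<open>x\<close> and
  the trial point. For large \<open>\<beta>\<close> the whole segment stays in the level set: along it, the objective
  is dominated by a function that is below its initial value as long as the segment has not
  left the level set.\<close>

lemma trial_point_sufficient_decrease:
  "\<exists>L>0. \<forall>i x y \<beta>. x \<in> C \<longrightarrow> L \<le> \<beta> \<longrightarrow> trial_point blk f F h g i x \<beta> y \<longrightarrow>
     S y + gsum y \<le> S x + gsum x - \<beta> / 2 * (norm (y - x))\<^sup>2"
proof -
  obtain Lf where Lf: "Lf-lipschitz_on C (grad f)" using grad_f_lipschitz by blast
  obtain LF where LF: "\<And>j. (LF j)-lipschitz_on C (gF j)" using gF_lipschitz by metis
  obtain H where H: "H > 0" "\<And>y. y \<in> C \<Longrightarrow> norm (grad h (F y)) \<le> H"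
    using bounded_on_level[OF continuous_on_compose2[OF continuous_grad_h continuous_F]] by auto
  \<comment> \<open>The Lipschitz constant of grad f, plus those of the gradients of the components
    of F weighted by the bound H for grad h on the level set; the 1 makes it positive if all of
    these vanish.\<close>
  define L where "L = Lf + H * (\<Sum>j\<in>UNIV. LF j) + 1"
  have Lf0: "0 \<le> Lf" and LF0: "\<And>j. 0 \<le> LF j" using Lf LF lipschitz_on_nonneg by blast+
  have L: "0 < L"
    unfolding L_def using Lf0 LF0 H(1) by (intro add_nonneg_pos add_nonneg_nonneg mult_nonneg_nonneg sum_nonneg) auto
  have main: "S y + gsum y \<le> S x + gsum x - \<beta> / 2 * (norm (y - x))\<^sup>2"
    if x: "x \<in> C" and \<beta>: "L \<le> \<beta>" and y: "trial_point blk f F h g i x \<beta> y" for i x y \<beta>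
  proof (cases "y = x")
    case False
    define d where "d = y - x"
    have d: "0 < (norm d)\<^sup>2" using False by (simp add: d_def)
    note xd = level_dom[OF x]
    note yd = trial_point_dom[OF xd y]
    let ?w = "F x + J x d"
    \<comment> \<open>The chord replaces \<open>gsum\<close>, so \<psi> is differentiable, dominates
      the objective along the segment and agrees with it at both ends.\<close>
    define \<psi> where "\<psi> = (\<lambda>t. S (x + t *\<^sub>R d) + (1 - t) * gsum x + t * gsum y)"
    have dec: "gsum y - gsum x \<le> - (grad f x \<bullet> d) + h (F x) - h ?w - \<beta> * (norm d)\<^sup>2"
      using trial_point_decrease[OF xd y] by (simp add: d_def)
    have seg: "x + t *\<^sub>R d \<in> edom \<phi>" "gsum (x + t *\<^sub>R d) \<le> (1 - t) * gsum x + t * gsum y"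
      if "0 \<le> t" "t \<le> 1" for t
      using segment_dom[OF xd yd that] by (simp_all add: d_def)
    have \<psi>_deriv: "(\<psi> has_real_derivative gS (x + t *\<^sub>R d) \<bullet> d + gsum y - gsum x) (at t)"
      if t: "0 \<le> t" "t \<le> 1" for t
    proof -
      have "((\<lambda>t. S (x + t *\<^sub>R d)) has_derivative (\<lambda>s. gS (x + t *\<^sub>R d) \<bullet> (s *\<^sub>R d))) (at t)"
        using S_deriv[OF seg(1)[OF t]] by (rule has_derivative_compose[rotated]) (auto intro!: derivative_eq_intros)
      then have "((\<lambda>t. S (x + t *\<^sub>R d)) has_real_derivative gS (x + t *\<^sub>R d) \<bullet> d) (at t)"
        unfolding has_field_derivative_def by (simp add: mult_commute_abs)
      then show ?thesis unfolding \<psi>_def by (auto intro!: derivative_eq_intros)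
    qed
    have bound: "\<psi> t \<le> \<psi> 0 - t * \<beta> * (norm d)\<^sup>2 + L / 2 * t\<^sup>2 * (norm d)\<^sup>2"
      if t: "0 \<le> t" "t \<le> 1" and le: "\<And>\<tau>. 0 \<le> \<tau> \<Longrightarrow> \<tau> \<le> t \<Longrightarrow> \<psi> \<tau> \<le> \<psi> 0" for t
    proof -
      \<comment> \<open>The bound on \<psi> carries over to the objective, so the points up to time
        t are in the level set and Taylor's estimate applies to them.\<close>
      have inC: "x + \<tau> *\<^sub>R d \<in> C" if \<tau>: "0 \<le> \<tau>" "\<tau> \<le> t" for \<tau>
      proof -
        have "S (x + \<tau> *\<^sub>R d) + gsum (x + \<tau> *\<^sub>R d) \<le> S x + gsum x"
          using le[OF \<tau>] seg(2)[of \<tau>] \<tau> t by (simp add: \<psi>_def)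
        then have "\<phi> (x + \<tau> *\<^sub>R d) \<le> \<phi> x"
          using seg(1)[of \<tau>] \<tau> t xd by (simp add: phi_eq)
        then show ?thesis using x by auto
      qed
      let ?Ft = "F (x + t *\<^sub>R d)" and ?r = "F (x + t *\<^sub>R d) - (F x + t *\<^sub>R J x d)"
      have "\<bar>f (x + t *\<^sub>R d) - f x - t * (grad f x \<bullet> d)\<bar> \<le> Lf * (norm d)\<^sup>2 / 2 * t\<^sup>2"
        using f_deriv[OF level_dom] Lf t(1) inC by (rule segment_taylor_bound)
      then have fle: "f (x + t *\<^sub>R d) \<le> f x + t * (grad f x \<bullet> d) + Lf * (norm d)\<^sup>2 / 2 * t\<^sup>2"
        by linarith
      have "\<bar>?r $ j\<bar> \<le> LF j * (norm d)\<^sup>2 / 2 * t\<^sup>2" for j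
      proof -
        have "\<bar>?Ft $ j - F x $ j - t * (gF j x \<bullet> d)\<bar> \<le> LF j * (norm d)\<^sup>2 / 2 * t\<^sup>2"
          using F_deriv[OF level_dom] LF t(1) inC by (rule segment_taylor_bound)
        then show ?thesis by (simp add: J_def algebra_simps)
      qed
      then have "norm ?r \<le> (\<Sum>j\<in>UNIV. LF j * (norm d)\<^sup>2 / 2 * t\<^sup>2)"
        by (intro order_trans[OF norm_le_l1_cart] sum_mono)
      also have "\<dots> = (\<Sum>j\<in>UNIV. LF j) * ((norm d)\<^sup>2 / 2 * t\<^sup>2)"
        by (simp add: sum_distrib_right mult.assoc)
      finally have r: "norm ?r \<le> (\<Sum>j\<in>UNIV. LF j) * ((norm d)\<^sup>2 / 2 * t\<^sup>2)" .
      have "grad h ?Ft \<bullet> ?r \<le> norm (grad h ?Ft) * norm ?r" by (rule norm_cauchy_schwarz)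
      also have "\<dots> \<le> H * ((\<Sum>j\<in>UNIV. LF j) * ((norm d)\<^sup>2 / 2 * t\<^sup>2))"
        using H(2)[OF inC[OF t(1) order_refl]] r H(1) by (intro mult_mono) auto
      finally have hr: "grad h ?Ft \<bullet> ?r \<le> H * ((\<Sum>j\<in>UNIV. LF j) * ((norm d)\<^sup>2 / 2 * t\<^sup>2))" .
      \<comment> \<open>The gradient inequality is taken at the true value of F, where the bound H
        on grad h applies.\<close>
      have "h ?Ft + grad h ?Ft \<bullet> (- ?r) \<le> h (F x + t *\<^sub>R J x d)"
        using convex_on_above_gradient[OF h_convex h_diff, of ?Ft "F x + t *\<^sub>R J x d"] by simp
      moreover have "h (F x + t *\<^sub>R J x d) \<le> (1 - t) * h (F x) + t * h ?w"
      proof -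
        have "h ((1 - t) *\<^sub>R F x + t *\<^sub>R ?w) \<le> (1 - t) * h (F x) + t * h ?w"
          using convex_onD[OF h_convex] t by auto
        then show ?thesis by (simp add: algebra_simps)
      qed
      ultimately have hle: "h ?Ft \<le> h (F x) + t * (h ?w - h (F x))
          + H * ((\<Sum>j\<in>UNIV. LF j) * ((norm d)\<^sup>2 / 2 * t\<^sup>2))"
        using hr by (simp add: algebra_simps)
      have "Lf * (norm d)\<^sup>2 / 2 * t\<^sup>2 + H * ((\<Sum>j\<in>UNIV. LF j) * ((norm d)\<^sup>2 / 2 * t\<^sup>2))
          = (L - 1) / 2 * t\<^sup>2 * (norm d)\<^sup>2"
        by (simp add: L_def algebra_simps)
      also have "\<dots> \<le> L / 2 * t\<^sup>2 * (norm d)\<^sup>2"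
        by (intro mult_right_mono) auto
      finally have quad: "Lf * (norm d)\<^sup>2 / 2 * t\<^sup>2 + H * ((\<Sum>j\<in>UNIV. LF j) * ((norm d)\<^sup>2 / 2 * t\<^sup>2))
          \<le> L / 2 * t\<^sup>2 * (norm d)\<^sup>2" .
      have "t * (gsum y - gsum x) \<le> t * (- (grad f x \<bullet> d) + h (F x) - h ?w - \<beta> * (norm d)\<^sup>2)"
        using dec t(1) by (rule mult_left_mono)
      moreover have "\<psi> t - \<psi> 0 = f (x + t *\<^sub>R d) - f x + (h ?Ft - h (F x)) + t * (gsum y - gsum x)"
        by (simp add: \<psi>_def S_def algebra_simps)
      ultimately show ?thesis using fle hle quad by (simp add: algebra_simps)
    qed
    have "\<psi> t \<le> \<psi> 0" if t: "0 \<le> t" "t \<le> 1" for t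
    proof (rule sublevel_continuation[OF _ _ _ t])
      show "continuous_on {0..1} \<psi>"
        using \<psi>_deriv by (intro DERIV_continuous_on) (auto intro: has_field_derivative_at_within)
      \<comment> \<open>The initial slope of \<psi> is negative: convexity of h compares its
        derivative at \<open>F x\<close> with the increment to \<open>?w\<close>.\<close>
      have "h (F x) + grad h (F x) \<bullet> (?w - F x) \<le> h ?w"
        by (rule convex_on_above_gradient[OF h_convex h_diff])
      then have "gS x \<bullet> d + gsum y - gsum x \<le> - \<beta> * (norm d)\<^sup>2"
        using dec by (simp add: gS_inner)
      also have "\<dots> < 0" using d \<beta> L by simp
      finally have "gS (x + 0 *\<^sub>R d) \<bullet> d + gsum y - gsum x < 0" by simp
      from DERIV_neg_dec_right[OF \<psi>_deriv[of 0] this]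
      obtain b where b: "b > 0" "\<And>s. 0 < s \<Longrightarrow> s < b \<Longrightarrow> \<psi> s < \<psi> 0" by auto
      then show "eventually (\<lambda>t. \<psi> t \<le> \<psi> 0) (at_right 0)"
        by (intro eventually_at_rightI[of 0 b]) (auto simp: less_imp_le)
    next
      fix t :: real assume t: "0 < t" "t \<le> 1" and le: "\<And>\<tau>. 0 \<le> \<tau> \<Longrightarrow> \<tau> \<le> t \<Longrightarrow> \<psi> \<tau> \<le> \<psi> 0"
      \<comment> \<open>Since t \<le> 1, the Taylor coefficient L/2 * t is below \<beta>, which
        gives the strict decrease.\<close>
      have "L / 2 * t < \<beta>" using t \<beta> L by (smt (verit) mult_left_le divide_pos_pos field_sum_of_halves)
      then have "L / 2 * t * (t * (norm d)\<^sup>2) < \<beta> * (t * (norm d)\<^sup>2)"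
        using t d by (intro mult_strict_right_mono) auto
      moreover have "L / 2 * t\<^sup>2 * (norm d)\<^sup>2 = L / 2 * t * (t * (norm d)\<^sup>2)"
        "t * \<beta> * (norm d)\<^sup>2 = \<beta> * (t * (norm d)\<^sup>2)"
        by (simp_all add: power2_eq_square)
      ultimately show "\<psi> t < \<psi> 0" using bound[OF _ t(2) le] t(1) by linarith
    qed
    then have "\<psi> 1 \<le> \<psi> 0 - 1 * \<beta> * (norm d)\<^sup>2 + L / 2 * 1\<^sup>2 * (norm d)\<^sup>2"
      by (intro bound) auto
    moreover have "L / 2 * (norm d)\<^sup>2 \<le> \<beta> / 2 * (norm d)\<^sup>2" using \<beta> by (intro mult_right_mono) auto
    ultimately have "\<psi> 1 \<le> \<psi> 0 - \<beta> / 2 * (norm d)\<^sup>2" by (simp add: field_simps)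
    then show ?thesis by (simp add: \<psi>_def d_def)
  qed simp
  show ?thesis using L main by (intro exI[of _ L]) blast
qed

subsection \<open>Subdifferentials\<close>

lemma S_isCont: "y \<in> edom \<phi> \<Longrightarrow> isCont S y"
  using S_deriv has_derivative_continuous by blast

lemma finite_phi_dom: "\<bar>\<phi> y\<bar> \<noteq> \<infinity> \<Longrightarrow> y \<in> edom \<phi>"
  by (auto simp: edom_def)

lemma phi_finite: "y \<in> edom \<phi> \<Longrightarrow> \<bar>\<phi> y\<bar> \<noteq> \<infinity>"
  by (simp add: phi_eq)

text \<open>The blocks of \<open>w\<close> are those of the vectors \<open>gS y + v i\<close>. The
  difference quotient is bounded below by the remainder \<open>r\<close> of the smooth part, since
  the subgradient inequalities add up over the blocks; outside the domain it is infinite.\<close>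

lemma limiting_subdiff_from_subgrads:
  assumes y: "y \<in> edom \<phi>" and v: "\<And>i. subgrad i y (v i)"
  shows "\<exists>w\<in>limiting_subdiff \<phi> y. norm w \<le> (\<Sum>i\<in>UNIV. norm (bp i (gS y + v i)))"
proof -
  define w where "w = (\<Sum>i\<in>UNIV. bp i (gS y + v i))"
  define r where "r = (\<lambda>z. (S z - S y - gS y \<bullet> (z - y)) / norm (z - y))"
  have g_le: "(w - gS y) \<bullet> (z - y) \<le> gsum z - gsum y" if z: "z \<in> edom \<phi>" for z
  proof -
    have "v i \<bullet> bp i (z - y) \<le> gr i z - gr i y" for i
      using subgradD[OF v[of i] y z] by (simp add: block_part_simps)
    then have "(\<Sum>i\<in>UNIV. v i \<bullet> bp i (z - y)) \<le> (\<Sum>i\<in>UNIV. gr i z - gr i y)"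
      by (rule sum_mono)
    moreover have "w = gS y + (\<Sum>i\<in>UNIV. bp i (v i))"
      by (simp add: w_def block_part_simps sum.distrib sum_block_part)
    ultimately show ?thesis
      by (simp add: gsum_def sum_subtractf inner_sum_left block_part_inner)
  qed
  have "(r \<longlongrightarrow> 0) (at y)"
  proof (rule tendsto_rabs_zero_cancel)
    show "((\<lambda>z. \<bar>r z\<bar>) \<longlongrightarrow> 0) (at y)"
      using S_deriv[OF y] by (simp add: has_derivative_iff_norm r_def)
  qed
  then have "((\<lambda>z. ereal (r z)) \<longlongrightarrow> ereal 0) (at y)" by (rule tendsto_ereal)
  then have "0 = Liminf (at y) (\<lambda>z. ereal (r z))"
    by (intro lim_imp_Liminf[symmetric]) (auto simp: zero_ereal_def)
  also have "\<dots> \<le> Liminf (at y) (\<lambda>z. (\<phi> z - \<phi> y - ereal (w \<bullet> (z - y))) / ereal (norm (z - y)))"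
  proof (rule Liminf_mono)
    have "ereal (r z) \<le> (\<phi> z - \<phi> y - ereal (w \<bullet> (z - y))) / ereal (norm (z - y))" if "z \<noteq> y" for z
    proof (cases "z \<in> edom \<phi>")
      case True
      have "S z - S y - gS y \<bullet> (z - y) \<le> S z + gsum z - (S y + gsum y) - w \<bullet> (z - y)"
        using g_le[OF True] by (simp add: inner_diff_left)
      then show ?thesis using that True y by (simp add: phi_eq r_def divide_right_mono)
    next
      case False
      then show ?thesis using that y by (simp add: phi_outside phi_eq)
    qed
    then show "eventually (\<lambda>z. ereal (r z) \<le>
        (\<phi> z - \<phi> y - ereal (w \<bullet> (z - y))) / ereal (norm (z - y))) (at y)"
      by (auto simp: eventually_at_filter)
  qed
  finally have "w \<in> frechet_subdiff \<phi> y" using phi_finite[OF y] by (simp add: frechet_subdiff_def)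
  then have "\<exists>u q. u \<longlonglongrightarrow> y \<and> (\<lambda>k. \<phi> (u k)) \<longlonglongrightarrow> \<phi> y \<and>
      (\<forall>k. q k \<in> frechet_subdiff \<phi> (u k)) \<and> q \<longlonglongrightarrow> w"
    by - (rule exI[of _ "\<lambda>_. y"], rule exI[of _ "\<lambda>_. w"], simp)
  then have "w \<in> limiting_subdiff \<phi> y"
    unfolding limiting_subdiff_def using phi_finite[OF y] by simp
  then show ?thesis unfolding w_def by (rule bexI[rotated]) (rule norm_sum)
qed

text \<open>A Frechet inequality holds near y up to o(|u - y|). Approaching y along the segment to z
  and using convexity of \<open>gsum\<close> turns it into a global one.\<close>

lemma frechet_subdiff_imp_convex:
  assumes w: "w \<in> frechet_subdiff \<phi> y" and z: "z \<in> edom \<phi>"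
  shows "gsum y + (w - gS y) \<bullet> (z - y) \<le> gsum z"
proof (cases "z = y")
  case False
  have y: "y \<in> edom \<phi>" using w finite_phi_dom by (simp add: frechet_subdiff_def)
  define d where "d = z - y"
  have d: "0 < norm d" using False by (simp add: d_def)
  have "gsum y \<le> gsum z + (gS y \<bullet> d - w \<bullet> d)"
  proof (rule directional_first_order_condition[where q = "\<lambda>t. S (y + t *\<^sub>R d) - w \<bullet> (t *\<^sub>R d)"])
    have "(S has_derivative (\<lambda>e. gS y \<bullet> e)) (at (y + 0 *\<^sub>R d))" using S_deriv[OF y] by simp
    then have "((\<lambda>t. S (y + t *\<^sub>R d)) has_derivative (\<lambda>s. gS y \<bullet> (s *\<^sub>R d))) (at 0)"
      by (rule has_derivative_compose[rotated]) (auto intro!: derivative_eq_intros)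
    then have "((\<lambda>t. S (y + t *\<^sub>R d)) has_real_derivative gS y \<bullet> d) (at 0)"
      unfolding has_field_derivative_def by (simp add: mult_commute_abs)
    then show "((\<lambda>t. S (y + t *\<^sub>R d) - w \<bullet> (t *\<^sub>R d)) has_real_derivative gS y \<bullet> d - w \<bullet> d) (at 0)"
      by (auto intro!: derivative_eq_intros)
  next
    fix e :: real assume e: "0 < e"
    \<comment> \<open>The difference quotient divides by t * norm d, so this choice makes the slack
      e * t.\<close>
    define e' where "e' = e / norm d"
    have "ereal (- e') < 0" using e d by (simp add: e'_def)
    also have "0 \<le> Liminf (at y) (\<lambda>u. (\<phi> u - \<phi> y - ereal (w \<bullet> (u - y))) / ereal (norm (u - y)))"
      using w by (simp add: frechet_subdiff_def)
    finally have ev: "eventually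
        (\<lambda>u. ereal (- e') < (\<phi> u - \<phi> y - ereal (w \<bullet> (u - y))) / ereal (norm (u - y))) (at y)"
      by (rule less_LiminfD)
    have lim: "filterlim (\<lambda>t. y + t *\<^sub>R d) (at y) (at_right 0)"
      unfolding filterlim_at
    proof
      show "eventually (\<lambda>t. y + t *\<^sub>R d \<in> UNIV \<and> y + t *\<^sub>R d \<noteq> y) (at_right 0)"
        using eventually_at_right_less[of 0] by eventually_elim (use d in auto)
      show "((\<lambda>t. y + t *\<^sub>R d) \<longlongrightarrow> y) (at_right 0)" by (auto intro!: tendsto_eq_intros)
    qed
    have ev1: "eventually (\<lambda>t. t \<in> {0<..<1::real}) (at_right 0)"
      by (rule eventually_at_rightI[of 0 1]) auto
    show "eventually (\<lambda>t. S (y + 0 *\<^sub>R d) - w \<bullet> (0 *\<^sub>R d) + gsum y - e * t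
        \<le> S (y + t *\<^sub>R d) - w \<bullet> (t *\<^sub>R d) + (1 - t) * gsum y + t * gsum z) (at_right 0)"
      using filterlim_iff[THEN iffD1, OF lim, rule_format, OF ev] ev1
    proof eventually_elim
      case (elim t)
      let ?u = "y + t *\<^sub>R d"
      have t: "0 \<le> t" "t \<le> 1" "0 < t" using elim(2) by auto
      have u: "?u \<in> edom \<phi>" and gu: "gsum ?u \<le> (1 - t) * gsum y + t * gsum z"
        using segment_dom[OF y z t(1,2)] by (simp_all add: d_def)
      have "- e' < (S ?u + gsum ?u - (S y + gsum y) - w \<bullet> (t *\<^sub>R d)) / (t * norm d)"
        using elim(1) t d by (simp add: phi_eq[OF u] phi_eq[OF y])
      then have "- e' * (t * norm d) < S ?u + gsum ?u - (S y + gsum y) - w \<bullet> (t *\<^sub>R d)"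
        using t d by (subst (asm) pos_less_divide_eq) auto
      moreover have "e' * (t * norm d) = e * t" using d by (simp add: e'_def)
      ultimately show ?case using gu by simp
    qed
  qed
  then show ?thesis by (simp add: d_def inner_diff_left)
qed simp

text \<open>The strict inequality keeps the approximating points inside the level set, the only place
  where the gradient is known to be continuous.\<close>

lemma limiting_subdiff_imp_subgrad:
  assumes y: "\<phi> y < \<phi> x\<^sub>0" and v: "v \<in> limiting_subdiff \<phi> y"
  shows "subgrad i y (v - gS y)"
proof -
  have yC: "y \<in> C" using y by simp
  note yd = level_dom[OF yC]
  obtain u w where u: "u \<longlonglongrightarrow> y" and \<phi>u: "(\<lambda>k. \<phi> (u k)) \<longlonglongrightarrow> \<phi> y"
    and w: "\<And>k. w k \<in> frechet_subdiff \<phi> (u k)" "w \<longlonglongrightarrow> v"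
    using v by (auto simp: limiting_subdiff_def)
  have ud: "u k \<in> edom \<phi>" for k using w(1)[of k] finite_phi_dom by (simp add: frechet_subdiff_def)
  have "eventually (\<lambda>k. u k \<in> C) sequentially"
    using order_tendstoD(2)[OF \<phi>u y] by eventually_elim auto
  then have gS: "(\<lambda>k. gS (u k)) \<longlonglongrightarrow> gS y"
    by (rule continuous_on_tendsto_compose[OF continuous_gS u yC])
  have "(\<lambda>k. ereal (S (u k) + gsum (u k))) \<longlonglongrightarrow> ereal (S y + gsum y)"
    using \<phi>u by (simp add: phi_eq ud yd)
  then have "(\<lambda>k. S (u k) + gsum (u k)) \<longlonglongrightarrow> S y + gsum y" by simp
  moreover have "(\<lambda>k. S (u k)) \<longlonglongrightarrow> S y" by (rule isCont_tendsto_compose[OF S_isCont[OF yd] u])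
  ultimately have "(\<lambda>k. S (u k) + gsum (u k) - S (u k)) \<longlonglongrightarrow> S y + gsum y - S y"
    by (rule tendsto_diff)
  then have gsum: "(\<lambda>k. gsum (u k)) \<longlonglongrightarrow> gsum y" by simp
  have le: "gsum y + (v - gS y) \<bullet> (z - y) \<le> gsum z" if z: "z \<in> edom \<phi>" for z
  proof (rule LIMSEQ_le_const2)
    show "(\<lambda>k. gsum (u k) + (w k - gS (u k)) \<bullet> (z - u k)) \<longlonglongrightarrow> gsum y + (v - gS y) \<bullet> (z - y)"
      by (intro tendsto_intros gsum gS u w)
    show "\<exists>N. \<forall>k\<ge>N. gsum (u k) + (w k - gS (u k)) \<bullet> (z - u k) \<le> gsum z"
      using frechet_subdiff_imp_convex[OF w(1) z] by blast
  qed
  show ?thesis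
    unfolding subgrad_def
  proof
    fix z assume z: "z \<in> V i"
    show "g i (bp i y) + ereal ((v - gS y) \<bullet> (z - bp i y)) \<le> g i z"
    proof (cases "g i z = \<infinity>")
      case False
      \<comment> \<open>Only block \<open>i\<close> is moved, so the joint inequality reduces to the
        one for g_i.\<close>
      let ?z = "y + (z - bp i y)"
      have zi: "bp i ?z = z" using z by (simp add: block_part_simps block_part_ident)
      have zl: "bp l ?z = bp l y" if "l \<noteq> i" for l
        using z that by (simp add: block_part_simps block_part_other block_part_other[OF block_part_mem])
      have zd: "?z \<in> edom \<phi>" using False yd zi zl unfolding edom_iff by metis
      have "gsum ?z - gsum y = (\<Sum>l\<in>UNIV. gr l ?z - gr l y)" by (simp add: gsum_def sum_subtractf)
      also have "\<dots> = (\<Sum>l\<in>UNIV. if l = i then gr l ?z - gr l y else 0)"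
        using zl by (intro sum.cong) (auto simp: gr_def)
      also have "\<dots> = gr i ?z - gr i y" by simp
      finally have "gr i y + (v - gS y) \<bullet> (z - bp i y) \<le> gr i ?z"
        using le[OF zd] by simp
      then show ?thesis using g_eq_gr[OF yd, of i] g_eq_gr[OF zd, of i] zi by simp
    qed simp
  qed
qed

text \<open>A relation, since an infimum over the empty set could pass off a missing subgradient as
  a small residual: without a subgradient no \<rho> qualifies.\<close>

definition resid :: "'b \<Rightarrow> real ^ 'n \<Rightarrow> real \<Rightarrow> bool" where
  "resid i y \<rho> \<longleftrightarrow> (\<exists>v. subgrad i y v \<and> norm (bp i (gS y + v)) \<le> \<rho>)"

lemma resid_mono: "resid i y \<rho> \<Longrightarrow> \<rho> \<le> \<rho>' \<Longrightarrow> resid i y \<rho>'"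
  unfolding resid_def by (meson order_trans)

lemma stat_dist_le:
  assumes y: "y \<in> edom \<phi>" and \<rho>: "\<And>i. resid i y (\<rho> i)"
  shows "limiting_subdiff \<phi> y \<noteq> {}" "stat_dist \<phi> y \<le> (\<Sum>i\<in>UNIV. \<rho> i)"
proof -
  obtain v where v: "\<And>i. subgrad i y (v i)" "\<And>i. norm (bp i (gS y + v i)) \<le> \<rho> i"
    using \<rho> unfolding resid_def by metis
  obtain w where w: "w \<in> limiting_subdiff \<phi> y" "norm w \<le> (\<Sum>i\<in>UNIV. norm (bp i (gS y + v i)))"
    using limiting_subdiff_from_subgrads[OF y v(1)] by blast
  then show "limiting_subdiff \<phi> y \<noteq> {}" by blast
  have "stat_dist \<phi> y \<le> norm w"
    using infdist_le[OF w(1), of 0] by (simp add: stat_dist_def)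
  also have "\<dots> \<le> (\<Sum>i\<in>UNIV. norm (bp i (gS y + v i)))" by (rule w(2))
  also have "\<dots> \<le> (\<Sum>i\<in>UNIV. \<rho> i)" using v(2) by (rule sum_mono)
  finally show "stat_dist \<phi> y \<le> (\<Sum>i\<in>UNIV. \<rho> i)" .
qed

text \<open>On a nonconvex level set \<open>F\<close>, hence \<open>gS\<close>, need not be Lipschitz; uniform continuity costs
  the additive error \<open>e\<close>.\<close>

lemma resid_step:
  assumes e: "0 < e" and B: "0 \<le> B"
  shows "\<exists>K\<ge>0. \<forall>x\<in>C. \<forall>y\<in>C.
    (\<forall>l \<rho>. bp l y = bp l x \<longrightarrow> resid l x \<rho> \<longrightarrow> resid l y (\<rho> + e + K * (norm (y - x))\<^sup>2)) \<and>
    (\<forall>i \<beta>. 0 \<le> \<beta> \<longrightarrow> \<beta> \<le> B \<longrightarrow> trial_point blk f F h g i x \<beta> y \<longrightarrow>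
      resid i y (e + K * (norm (y - x))\<^sup>2))"
proof -
  have e2: "0 < e / 2" using e by simp
  obtain K where K: "K \<ge> 0"
    "\<And>x y. x \<in> C \<Longrightarrow> y \<in> C \<Longrightarrow> norm (gS x - gS y) \<le> e / 2 + K * (dist x y)\<^sup>2"
    using continuous_modulus_quadratic[OF level_compact' continuous_gS e2] by blast
  obtain Lh where Lh: "Lh-lipschitz_on UNIV (grad h)" using grad_h_lipschitz by blast
  obtain Q where Q: "\<And>j. Q j > 0" "\<And>j y. y \<in> C \<Longrightarrow> norm (gF j y) \<le> Q j"
    using bounded_on_level[OF continuous_gF] by metis
  define q where "q = (\<Sum>j\<in>UNIV. Q j)"
  \<comment> \<open>The linear part of the residual in |d|: grad h changes by at most Lh q |d|, the
    transposed Jacobian contributes another factor q, and the proximal term at most B.\<close>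
  define c where "c = Lh * q * q + B"
  \<comment> \<open>Half of e covers the modulus of \<open>gS\<close>, the other half the passage
    from c |d| to a square.\<close>
  define K' where "K' = K + c\<^sup>2 / (e / 2)"
  have Lh0: "0 \<le> Lh" using Lh lipschitz_on_nonneg by blast
  have q0: "0 \<le> q" unfolding q_def using Q(1) by (intro sum_nonneg) (auto simp: less_imp_le)
  have KK': "K * (norm d)\<^sup>2 \<le> K' * (norm d)\<^sup>2" for d :: "real ^ 'n"
    using e by (intro mult_right_mono) (auto simp: K'_def)
  have change: "norm (gS y - gS x) \<le> e / 2 + K * (norm (y - x))\<^sup>2" if "x \<in> C" "y \<in> C" for x y
    using K(2)[OF that(2,1)] by (simp add: dist_norm)
  have 1: "resid l y (\<rho> + e + K' * (norm (y - x))\<^sup>2)"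
    if xy: "x \<in> C" "y \<in> C" and l: "bp l y = bp l x" and \<rho>: "resid l x \<rho>" for x y l \<rho>
  proof -
    obtain v where v: "subgrad l x v" "norm (bp l (gS x + v)) \<le> \<rho>"
      using \<rho> by (auto simp: resid_def)
    \<comment> \<open>Block \<open>l\<close> is unchanged, so the old subgradient remains one and
      only the gradient varies.\<close>
    have "bp l (gS y + v) = bp l (gS x + v) + bp l (gS y - gS x)" by (simp add: block_part_simps)
    then have "norm (bp l (gS y + v)) \<le> norm (bp l (gS x + v)) + norm (bp l (gS y - gS x))"
      by (metis norm_triangle_ineq)
    also have "\<dots> \<le> \<rho> + (e / 2 + K * (norm (y - x))\<^sup>2)"
      using v(2) change[OF xy] norm_block_part_le[of blk l "gS y - gS x"] by linarith
    also have "\<dots> \<le> \<rho> + e + K' * (norm (y - x))\<^sup>2" using KK'[of "y - x"] e by simp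
    finally show ?thesis using v(1) l unfolding resid_def subgrad_def by metis
  qed
  have 2: "resid i y (e + K' * (norm (y - x))\<^sup>2)"
    if xy: "x \<in> C" "y \<in> C" and \<beta>: "0 \<le> \<beta>" "\<beta> \<le> B" and tp: "trial_point blk f F h g i x \<beta> y"
    for x y i \<beta>
  proof -
    define d where "d = y - x"
    define \<Delta> where "\<Delta> = grad h (F x) - grad h (F x + J x d)"
    let ?v = "- model_grad x \<beta> d"
    have Jd: "norm (J x d) \<le> q * norm d"
    proof -
      have "norm (J x d) \<le> (\<Sum>j\<in>UNIV. \<bar>gF j x \<bullet> d\<bar>)"
        using norm_le_l1_cart[of "J x d"] by (simp add: J_def)
      also have "\<dots> \<le> (\<Sum>j\<in>UNIV. Q j * norm d)"
        by (intro sum_mono order_trans[OF Cauchy_Schwarz_ineq2] mult_right_mono Q(2) xy) auto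
      finally show ?thesis by (simp add: q_def sum_distrib_right)
    qed
    have "norm \<Delta> \<le> Lh * norm (J x d)"
      using lipschitz_onD[OF Lh, of "F x" "F x + J x d"] by (simp add: \<Delta>_def dist_norm)
    also have "\<dots> \<le> Lh * (q * norm d)" using Jd Lh0 by (rule mult_left_mono)
    finally have \<Delta>: "norm \<Delta> \<le> Lh * (q * norm d)" .
    have "norm (\<Sum>j\<in>UNIV. (\<Delta> $ j) *\<^sub>R gF j x) \<le> (\<Sum>j\<in>UNIV. norm \<Delta> * Q j)"
      using Q(2)[OF xy(1)] component_le_norm_cart[of \<Delta>]
      by (intro sum_norm_le) (auto intro!: mult_mono)
    also have "\<dots> = norm \<Delta> * q" by (simp add: q_def sum_distrib_left)
    also have "\<dots> \<le> Lh * (q * norm d) * q" using \<Delta> q0 by (rule mult_right_mono)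
    finally have \<Delta>': "norm (\<Sum>j\<in>UNIV. (\<Delta> $ j) *\<^sub>R gF j x) \<le> Lh * (q * norm d) * q" .
    \<comment> \<open>The gradient of f at \<open>x\<close> cancels; the linearization of h leaves
      \<open>\<Delta>\<close>.\<close>
    have veq: "gS y + ?v = (gS y - gS x) + (\<Sum>j\<in>UNIV. (\<Delta> $ j) *\<^sub>R gF j x) - \<beta> *\<^sub>R d"
      by (simp add: gS_def[of x] model_grad_def \<Delta>_def sum_subtractf algebra_simps)
    have "norm (gS y + ?v) \<le> norm (gS y - gS x) + norm (\<Sum>j\<in>UNIV. (\<Delta> $ j) *\<^sub>R gF j x) + norm (\<beta> *\<^sub>R d)"
      unfolding veq
      using norm_triangle_ineq4[of "(gS y - gS x) + (\<Sum>j\<in>UNIV. (\<Delta> $ j) *\<^sub>R gF j x)" "\<beta> *\<^sub>R d"]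
        norm_triangle_ineq[of "gS y - gS x" "\<Sum>j\<in>UNIV. (\<Delta> $ j) *\<^sub>R gF j x"] by linarith
    also have "\<dots> \<le> (e / 2 + K * (norm d)\<^sup>2) + Lh * (q * norm d) * q + B * norm d"
      using change[OF xy] \<Delta>' \<beta> by (intro add_mono) (auto simp: d_def mult_right_mono)
    also have "\<dots> = e / 2 + K * (norm d)\<^sup>2 + c * norm d" by (simp add: c_def algebra_simps)
    also have "\<dots> \<le> e / 2 + K * (norm d)\<^sup>2 + (e / 2 + c\<^sup>2 / (e / 2) * (norm d)\<^sup>2)"
      using linear_le_quadratic[OF e2] by (rule add_left_mono)
    also have "\<dots> = e + K' * (norm d)\<^sup>2" by (simp add: K'_def algebra_simps)
    finally have "norm (bp i (gS y + ?v)) \<le> e + K' * (norm d)\<^sup>2"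
      by (rule order_trans[OF norm_block_part_le])
    then show ?thesis
      using trial_point_subgrad[OF level_dom[OF xy(1)] tp] unfolding resid_def d_def by blast
  qed
  have "0 \<le> K'" using K(1) e by (simp add: K'_def)
  then show ?thesis using 1 2 by (intro exI[of _ K']) blast
qed

subsection \<open>Line search\<close>

abbreviation "LS \<equiv> line_search blk f F h g"

lemma line_search_stopped:
  "LS i y R b \<beta> z \<Longrightarrow> trial_point blk f F h g i y \<beta> z \<and> accepted \<phi> y R \<beta> z"
  by (induction rule: line_search.induct) (auto simp: \<phi>_def)

lemma line_search_ge:
  "LS i y R b \<beta> z \<Longrightarrow> 0 < b \<Longrightarrow> 2 * b \<le> \<beta>"
  by (induction rule: line_search.induct) auto

lemma line_search_power: "LS i y R b \<beta> z \<Longrightarrow> \<exists>j. \<beta> = 2 ^ j * b"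
proof (induction rule: line_search.induct)
  case (stop b y)
  show ?case by (rule exI[of _ 1]) simp
next
  case (retry b z \<beta> y)
  then obtain j where "\<beta> = 2 ^ j * (2 * b)" by blast
  then show ?case by (intro exI[of _ "Suc j"]) simp
qed

lemma line_search_unique:
  assumes y: "y \<in> edom \<phi>"
  shows "LS i y R b \<beta> z \<Longrightarrow> LS i y R b \<beta>' z' \<Longrightarrow> 0 < b \<Longrightarrow> \<beta> = \<beta>' \<and> z = z'"
proof (induction arbitrary: \<beta>' z' rule: line_search.induct)
  case (stop b z)
  have uniq: "z = w" if "trial_point blk f F h g i y (2 * b) w" for w
    using trial_point_unique[OF y _ stop(1) that] stop(4) by simp
  from stop(3) show ?case
  proof cases
    case stop then show ?thesis using uniq by blast
  next
    case (retry w) then show ?thesis using uniq stop(2) by blast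
  qed
next
  case (retry b w \<beta> z)
  note IH = retry(4) and b = retry(6)
  have uniq: "w = v" if "trial_point blk f F h g i y (2 * b) v" for v
    using trial_point_unique[OF y _ retry(1) that] retry(6) by simp
  from retry(5) show ?case
  proof cases
    case stop then show ?thesis using uniq retry(2) by blast
  next
    case (retry v) then show ?thesis using IH b by simp
  qed
qed

lemma accepted_mono: "accepted \<psi> y R \<beta> z \<Longrightarrow> R \<le> R' \<Longrightarrow> accepted \<psi> y R' \<beta> z"
  unfolding accepted_def by (erule order_trans) simp

text \<open>A trial accepted with \<open>R1\<close> is accepted with \<open>R\<close>, and one
  rejected with \<open>R2\<close> is rejected with \<open>R\<close>. Hence the reference values with
  a given outcome form an interval.\<close>

lemma line_search_between:
  assumes y: "y \<in> edom \<phi>" and R: "R1 \<le> R" "R \<le> R2"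
  shows "LS i y R1 b \<beta> z \<Longrightarrow> LS i y R2 b \<beta> z \<Longrightarrow> 0 < b \<Longrightarrow> LS i y R b \<beta> z"
proof (induction rule: line_search.induct)
  case (stop b z)
  have "accepted (objective blk f F h g) y R (2 * b) z"
    using stop(2) R(1) by (rule accepted_mono)
  then show ?case by (rule line_search.stop[OF stop(1)])
next
  case (retry b w \<beta> z)
  note w = retry(1) and IH = retry(4) and b = retry(6)
  have gt: "2 * (2 * b) \<le> \<beta>" using line_search_ge[OF retry(3)] retry(6) by simp
  have uniq: "w = v" if "trial_point blk f F h g i y (2 * b) v" for v
    using trial_point_unique[OF y _ retry(1) that] retry(6) by simp
  from retry(5) show ?case
  proof cases
    case stop then show ?thesis using gt b by simp
  next
    case (retry v)
    then have "\<not> accepted (objective blk f F h g) y R2 (2 * b) w" using uniq by blast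
    then have "\<not> accepted (objective blk f F h g) y R (2 * b) w"
      using R(2) accepted_mono by blast
    moreover have "LS i y R (2 * b) \<beta> z"
      using IH b retry by simp
    ultimately show ?thesis by (rule line_search.retry[OF w])
  qed
qed

text \<open>The reference value is the only quantity driving the algorithm that is not confined to a
  countable set; this makes the iterates measurable.\<close>

lemma line_search_borel:
  assumes "y \<in> edom \<phi>" "0 < b"
  shows "{R. LS i y R b \<beta> z} \<in> sets borel"
  by (rule real_interval_borel_measurable)
    (use line_search_between[OF assms(1)] assms(2) in \<open>auto simp: is_interval_1\<close>)

text \<open>A rejected parameter is below L, so its double is below 2L; without any rejection the
  parameter is that of the first trial, 2b.\<close>

lemma line_search_bounded:
  "\<exists>L>0. \<forall>i y R b \<beta> z. y \<in> C \<longrightarrow> \<phi> y \<le> ereal R \<longrightarrow> 0 < b \<longrightarrow> LS i y R b \<beta> z \<longrightarrow>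
     \<beta> \<le> max (2 * b) (2 * L)"
proof -
  obtain L where L: "L > 0"
    "\<And>i x y \<beta>. x \<in> C \<Longrightarrow> L \<le> \<beta> \<Longrightarrow> trial_point blk f F h g i x \<beta> y \<Longrightarrow>
      S y + gsum y \<le> S x + gsum x - \<beta> / 2 * (norm (y - x))\<^sup>2"
    using trial_point_sufficient_decrease by blast
  have "\<beta> \<le> max (2 * b) (2 * L)"
    if y: "y \<in> C" and R: "\<phi> y \<le> ereal R" and ls: "LS i y R b \<beta> z" and b: "0 < b" for i y R b \<beta> z
    using ls b
  proof (induction rule: line_search.induct)
    case (retry b w \<beta> z)
    have "2 * b < L"
    proof (rule ccontr)
      assume "\<not> 2 * b < L"
      then have "S w + gsum w \<le> S y + gsum y - 2 * b / 2 * (norm (w - y))\<^sup>2"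
        using L(2)[OF y _ retry(1)] by simp
      moreover have "S y + gsum y \<le> R" using R by (simp add: phi_eq level_dom[OF y])
      ultimately have "accepted \<phi> y R (2 * b) w"
        by (simp add: accepted_def phi_eq trial_point_dom[OF level_dom[OF y] retry(1)])
      then show False using retry(2) by (simp add: \<phi>_def)
    qed
    then show ?case using retry by simp
  qed simp
  then show ?thesis using L(1) by blast
qed

end

section \<open>Runs of the algorithm\<close>

locale libcod_run = composite_problem blk f F h g x\<^sub>0
  for blk :: "'n::finite \<Rightarrow> 'b::finite"
    and f :: "real ^ 'n \<Rightarrow> real"
    and F :: "real ^ 'n \<Rightarrow> real ^ 'm::finite"
    and h :: "real ^ 'm \<Rightarrow> real"
    and g :: "'b \<Rightarrow> real ^ 'n \<Rightarrow> ereal"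
    and x\<^sub>0 :: "real ^ 'n" +
  fixes \<beta>\<^sub>1 \<beta>min pmin umin :: real and p :: "'b \<Rightarrow> real"
    and M :: "'w measure" and G :: "nat \<Rightarrow> 'w measure" and I :: "nat \<Rightarrow> 'w \<Rightarrow> 'b"
    and u b \<beta> R :: "nat \<Rightarrow> 'w \<Rightarrow> real" and x :: "nat \<Rightarrow> 'w \<Rightarrow> real ^ 'n"
  assumes libcod: "nonmonotone_libcod blk f F h g x\<^sub>0 \<beta>\<^sub>1 \<beta>min pmin umin p M G I u b \<beta> R x"
begin

lemma params: "0 < \<beta>min" "\<beta>min / 2 \<le> \<beta>\<^sub>1" "0 < umin" "0 < pmin" "pmin \<le> p i"
  using libcod by (auto simp: nonmonotone_libcod_def)

sublocale prob_space M
  using libcod by (simp add: nonmonotone_libcod_def)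

lemma G_sub: "subalgebra M (G k)"
  and G_filtration: "filtration (space M) G"
  and I_meas: "I k \<in> measurable (G (Suc k)) (count_space UNIV)"
  and u_meas: "u (Suc k) \<in> borel_measurable (G (Suc k))"
  and draw: "A \<in> sets (G k) \<Longrightarrow> prob (A \<inter> {\<omega>\<in>space M. I k \<omega> = i}) = prob A * p i"
  using libcod by (auto simp: nonmonotone_libcod_def)

lemma G_space: "space (G k) = space M"
  using G_sub by (simp add: subalgebra_def)

lemma G_mono: "j \<le> k \<Longrightarrow> X \<in> measurable (G j) N \<Longrightarrow> X \<in> measurable (G k) N"
  using filtration.sets_F_mono[OF G_filtration, of j k]
  by (auto simp: measurable_def G_space)

lemma G_to_M: "X \<in> measurable (G k) N \<Longrightarrow> X \<in> measurable M N"
  using G_sub[of k] by (auto simp: measurable_def subalgebra_def)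

lemma draw_event: "{\<omega>\<in>space M. I k \<omega> = i} \<in> sets (G (Suc k))"
  using measurable_sets[OF I_meas[of k], of "{i}"]
  by (simp add: G_space vimage_def Int_def conj_commute)

lemma draw_event_M: "{\<omega>\<in>space M. I k \<omega> = i} \<in> events"
  using draw_event[of k i] G_sub[of "Suc k"] by (auto simp: subalgebra_def)

lemma p_pos: "0 < p i"
  using params(4) params(5)[of i] by linarith

lemma p_le_1: "p i \<le> 1"
proof -
  have "prob (space M \<inter> {\<omega>\<in>space M. I 0 \<omega> = i}) = prob (space M) * p i"
    by (rule draw[of _ 0]) (metis G_space sets.top)
  then show ?thesis by (metis mult_1 prob_le_1 prob_space)
qed

section \<open>Pathwise estimates\<close>

definition \<Phi> :: "real ^ 'n \<Rightarrow> real" where "\<Phi> y = S y + gsum y"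

lemma phi_\<Phi>: "y \<in> edom \<phi> \<Longrightarrow> \<phi> y = ereal (\<Phi> y)"
  by (simp add: phi_eq \<Phi>_def)

lemma level_iff: "y \<in> edom \<phi> \<Longrightarrow> y \<in> C \<longleftrightarrow> \<Phi> y \<le> \<Phi> x\<^sub>0"
  by (simp add: phi_\<Phi> x0_dom')

lemma start:
  assumes "\<omega> \<in> space M"
  shows "x 0 \<omega> = x\<^sub>0" "b 0 \<omega> = \<beta>\<^sub>1" "R 0 \<omega> = \<Phi> x\<^sub>0"
proof -
  have "x 0 \<omega> = x\<^sub>0 \<and> b 0 \<omega> = \<beta>\<^sub>1 \<and> ereal (R 0 \<omega>) = \<phi> x\<^sub>0"
    using libcod assms by (simp add: nonmonotone_libcod_def \<phi>_def)
  then show "x 0 \<omega> = x\<^sub>0" "b 0 \<omega> = \<beta>\<^sub>1" "R 0 \<omega> = \<Phi> x\<^sub>0"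
    by (simp_all add: phi_\<Phi> x0_dom')
qed

lemma step:
  assumes "\<omega> \<in> space M"
  shows "LS (I k \<omega>) (x k \<omega>) (R k \<omega>) (b k \<omega>) (\<beta> (Suc k) \<omega>) (x (Suc k) \<omega>)"
    "umin < u (Suc k) \<omega>" "u (Suc k) \<omega> < 1"
    "ereal (R (Suc k) \<omega>) = ereal ((1 - u (Suc k) \<omega>) * R k \<omega>)
        + ereal (u (Suc k) \<omega>) * \<phi> (x (Suc k) \<omega>)"
    "b (Suc k) \<omega> = max (\<beta> (Suc k) \<omega> / 4) (\<beta>min / 2)"
  using libcod assms by (simp_all add: nonmonotone_libcod_def \<phi>_def)

lemma b_ge: "\<omega> \<in> space M \<Longrightarrow> \<beta>min / 2 \<le> b k \<omega>"
  using start(2) step(5) params(2) by (cases k) auto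

lemma b_pos: "\<omega> \<in> space M \<Longrightarrow> 0 < b k \<omega>"
  using b_ge[of \<omega> k] params(1) by linarith

lemma \<beta>_ge: "\<omega> \<in> space M \<Longrightarrow> \<beta>min \<le> \<beta> (Suc k) \<omega>"
  using line_search_ge[OF step(1) b_pos, of \<omega> k] b_ge[of \<omega> k] by simp

lemma x_dom: "\<omega> \<in> space M \<Longrightarrow> x k \<omega> \<in> edom \<phi>"
proof (induction k)
  case (Suc k)
  then show ?case using trial_point_dom line_search_stopped[OF step(1)] by blast
qed (simp add: start x0_dom')

lemma accepted_step:
  assumes "\<omega> \<in> space M"
  shows "\<Phi> (x (Suc k) \<omega>) \<le> R k \<omega> - \<beta> (Suc k) \<omega> / 2 * (norm (x (Suc k) \<omega> - x k \<omega>))\<^sup>2"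
  using line_search_stopped[OF step(1)[OF assms, of k]] x_dom[OF assms, of "Suc k"]
  by (simp add: accepted_def phi_\<Phi>)

lemma R_Suc:
  assumes "\<omega> \<in> space M"
  shows "R (Suc k) \<omega> = (1 - u (Suc k) \<omega>) * R k \<omega> + u (Suc k) \<omega> * \<Phi> (x (Suc k) \<omega>)"
  using step(4)[OF assms, of k] by (simp add: phi_\<Phi>[OF x_dom[OF assms]])

text \<open>The new reference value is a convex combination of the old one and the new objective
  value; the latter has weight above umin, so at least that share of the accepted decrease passes to
  \<open>R\<close>.\<close>

lemma R_step:
  assumes \<omega>: "\<omega> \<in> space M"
  shows "\<Phi> (x (Suc k) \<omega>) \<le> R (Suc k) \<omega>"
    and "R (Suc k) \<omega> \<le> R k \<omega> - umin * \<beta>min / 2 * (norm (x (Suc k) \<omega> - x k \<omega>))\<^sup>2"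
proof -
  let ?d2 = "(norm (x (Suc k) \<omega> - x k \<omega>))\<^sup>2" and ?u = "u (Suc k) \<omega>"
  have "\<beta>min / 2 * ?d2 \<le> \<beta> (Suc k) \<omega> / 2 * ?d2"
    using \<beta>_ge[OF \<omega>, of k] by (intro mult_right_mono) auto
  then have dec: "\<beta>min / 2 * ?d2 \<le> R k \<omega> - \<Phi> (x (Suc k) \<omega>)"
    using accepted_step[OF \<omega>, of k] by linarith
  have d0: "0 \<le> \<beta>min / 2 * ?d2" using params(1) by simp
  have "0 \<le> (1 - ?u) * (R k \<omega> - \<Phi> (x (Suc k) \<omega>))"
    using step(3)[OF \<omega>, of k] dec d0 by (intro mult_nonneg_nonneg) linarith+
  then show "\<Phi> (x (Suc k) \<omega>) \<le> R (Suc k) \<omega>"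
    by (simp add: R_Suc[OF \<omega>] algebra_simps)
  have "umin * (\<beta>min / 2 * ?d2) \<le> ?u * (R k \<omega> - \<Phi> (x (Suc k) \<omega>))"
    using step(2)[OF \<omega>, of k] dec d0 params(3) by (intro mult_mono) linarith+
  then show "R (Suc k) \<omega> \<le> R k \<omega> - umin * \<beta>min / 2 * ?d2"
    by (simp add: R_Suc[OF \<omega>] algebra_simps)
qed

lemma R_antimono: "\<omega> \<in> space M \<Longrightarrow> R (Suc k) \<omega> \<le> R k \<omega>"
  using R_step(2)[of \<omega> k] params(1,3) by (smt (verit) divide_nonneg_pos mult_nonneg_nonneg zero_le_power2)

lemma \<Phi>_le_R: "\<omega> \<in> space M \<Longrightarrow> \<Phi> (x k \<omega>) \<le> R k \<omega>"
  using R_step(1) start by (cases k) auto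

lemma R_le: "\<omega> \<in> space M \<Longrightarrow> R k \<omega> \<le> \<Phi> x\<^sub>0"
proof (induction k)
  case (Suc k)
  then show ?case using R_antimono[of \<omega> k] by simp
qed (simp add: start)

lemma x_level: "\<omega> \<in> space M \<Longrightarrow> x k \<omega> \<in> C"
  using \<Phi>_le_R[of \<omega> k] R_le[of \<omega> k] by (subst level_iff[OF x_dom]) auto

text \<open>As \<open>R\<close> never exceeds the initial value, an iterate at that value is reached
  only by a step of length zero. This settles the case that
  \<open>limiting_subdiff_imp_subgrad\<close> excludes.\<close>

lemma x_eq_start:
  "\<omega> \<in> space M \<Longrightarrow> \<Phi> (x k \<omega>) = \<Phi> x\<^sub>0 \<Longrightarrow> x k \<omega> = x\<^sub>0"
proof (induction k)
  case (Suc k)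
  note \<omega> = Suc(2)
  have "\<beta> (Suc k) \<omega> / 2 * (norm (x (Suc k) \<omega> - x k \<omega>))\<^sup>2 \<le> 0"
    using accepted_step[OF \<omega>, of k] R_le[OF \<omega>, of k] Suc(3) by linarith
  moreover have "0 < \<beta> (Suc k) \<omega>" using \<beta>_ge[OF \<omega>, of k] params(1) by linarith
  ultimately have "x (Suc k) \<omega> = x k \<omega>" by (simp add: mult_le_0_iff)
  then show ?case using Suc by simp
qed (simp add: start)

lemma \<beta>_bounded: "\<exists>B\<ge>0. \<forall>\<omega>\<in>space M. \<forall>k. \<beta> (Suc k) \<omega> \<le> B"
proof -
  obtain L where L: "L > 0" "\<And>i y R b \<beta> z. y \<in> C \<Longrightarrow> \<phi> y \<le> ereal R \<Longrightarrow> 0 < b \<Longrightarrow>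
      LS i y R b \<beta> z \<Longrightarrow> \<beta> \<le> max (2 * b) (2 * L)"
    using line_search_bounded by blast
  \<comment> \<open>An invariant for the starting parameters: the search reaches at most 2B, and
    division by 4 returns below B; \<open>\<beta>\<^sub>1\<close> also bounds the floor
    \<open>\<beta>min / 2\<close>.\<close>
  define B where "B = max \<beta>\<^sub>1 L"
  have \<beta>le: "\<beta> (Suc k) \<omega> \<le> max (2 * b k \<omega>) (2 * L)" if \<omega>: "\<omega> \<in> space M" for \<omega> k
    using L(2)[OF x_level[OF \<omega>] _ b_pos[OF \<omega>] step(1)[OF \<omega>]] \<Phi>_le_R[OF \<omega>]
    by (simp add: phi_\<Phi>[OF x_dom[OF \<omega>]])
  have ble: "b k \<omega> \<le> B" if \<omega>: "\<omega> \<in> space M" for \<omega> k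
  proof (induction k)
    case (Suc k)
    have "\<beta> (Suc k) \<omega> \<le> 2 * B" using \<beta>le[OF \<omega>, of k] Suc by (auto simp: B_def)
    then show ?case using step(5)[OF \<omega>, of k] params(1,2) L(1) by (auto simp: B_def)
  qed (simp add: start[OF \<omega>] B_def)
  have "\<beta> (Suc k) \<omega> \<le> 2 * B" if \<omega>: "\<omega> \<in> space M" for \<omega> k
    using \<beta>le[OF \<omega>, of k] ble[OF \<omega>, of k] by (auto simp: B_def)
  then show ?thesis using L(1) by (intro exI[of _ "2 * B"]) (auto simp: B_def)
qed

lemma x_Suc_other:
  assumes "\<omega> \<in> space M" "l \<noteq> I k \<omega>"
  shows "bp l (x (Suc k) \<omega>) = bp l (x k \<omega>)"
  by (rule trial_point_diff(3)[OF conjunct1[OF line_search_stopped[OF step(1)[OF assms(1)]]] assms(2)])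

lemma undrawn_block:
  "\<omega> \<in> space M \<Longrightarrow> \<forall>l<k. I l \<omega> \<noteq> i \<Longrightarrow> bp i (x k \<omega>) = bp i x\<^sub>0"
proof (induction k)
  case (Suc k)
  then show ?case using x_Suc_other[of \<omega> i k] by auto
qed (simp add: start)

text \<open>A state has countably many successors: finitely many blocks, a power of two for the
  parameter, and then at most one trial point. So the discrete sigma-algebra can be used for states,
  which makes every function of the iterate measurable. The weights \<open>u\<close> are arbitrary
  reals, hence \<open>R\<close> is carried along as a Borel variable.\<close>

lemma state_measurable:
  "(\<lambda>\<omega>. (x k \<omega>, b k \<omega>)) \<in> measurable (G k) (count_space UNIV) \<and>
   countable ((\<lambda>\<omega>. (x k \<omega>, b k \<omega>)) ` space M) \<and> R k \<in> borel_measurable (G k)"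
proof (induction k)
  case 0
  have "(\<lambda>\<omega>. (x 0 \<omega>, b 0 \<omega>)) \<in> measurable (G 0) (count_space UNIV) \<longleftrightarrow>
      (\<lambda>\<omega>. (x\<^sub>0, \<beta>\<^sub>1)) \<in> measurable (G 0) (count_space UNIV)"
    by (rule measurable_cong) (simp add: G_space start)
  moreover have "R 0 \<in> borel_measurable (G 0) \<longleftrightarrow> (\<lambda>\<omega>. \<Phi> x\<^sub>0) \<in> borel_measurable (G 0)"
    by (rule measurable_cong) (simp add: G_space start)
  moreover have "(\<lambda>\<omega>. (x 0 \<omega>, b 0 \<omega>)) ` space M \<subseteq> {(x\<^sub>0, \<beta>\<^sub>1)}" by (auto simp: start)
  then have "countable ((\<lambda>\<omega>. (x 0 \<omega>, b 0 \<omega>)) ` space M)" by (rule countable_subset) simp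
  ultimately show ?case by simp
next
  case (Suc k)
  let ?s = "\<lambda>\<omega>. (x k \<omega>, b k \<omega>)" and ?t = "\<lambda>\<omega>. (x (Suc k) \<omega>, \<beta> (Suc k) \<omega>)"
  have s: "?s \<in> measurable (G (Suc k)) (count_space UNIV)"
    and R: "R k \<in> borel_measurable (G (Suc k))"
    using Suc by (auto intro: G_mono[of k])
  have s_set: "{\<omega>\<in>space M. ?s \<omega> = a} \<in> sets (G (Suc k))" for a
    using measurable_sets[OF s, of "{a}"] by (simp add: G_space vimage_def Int_def conj_commute)
  have range: "countable (?t ` space M)"
  proof (rule countable_subset)
    \<comment> \<open>The possible outcomes from a state (a, c) with block \<open>i\<close> and
      parameter \<open>2 ^ j * c\<close>: at most one.\<close>
    define T where "T = (\<lambda>(i, a, c) j. {(y, 2 ^ j * c) |y. trial_point blk f F h g i a (2 ^ j * c) y})"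
    show "?t ` space M \<subseteq> (\<Union>q\<in>UNIV \<times> ?s ` space M. \<Union>j. T q j)"
    proof clarify
      fix \<omega> assume \<omega>: "\<omega> \<in> space M"
      obtain j where j: "\<beta> (Suc k) \<omega> = 2 ^ j * b k \<omega>" using line_search_power[OF step(1)[OF \<omega>]] by blast
      have "?t \<omega> \<in> T (I k \<omega>, ?s \<omega>) j"
        using line_search_stopped[OF step(1)[OF \<omega>, of k]] j by (auto simp: T_def)
      then show "?t \<omega> \<in> (\<Union>q\<in>UNIV \<times> ?s ` space M. \<Union>j. T q j)" using \<omega> by blast
    qed
    have "countable (T q j)" if q: "q \<in> UNIV \<times> ?s ` space M" for q j
    proof -
      obtain i \<omega> where q': "q = (i, ?s \<omega>)" "\<omega> \<in> space M" using q by auto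
      have "0 < 2 ^ j * b k \<omega>" using b_pos[OF q'(2)] by simp
      then have "a = a'" if "a \<in> T q j" "a' \<in> T q j" for a a'
        using that trial_point_unique[OF x_dom[OF q'(2)]] by (auto simp: T_def q'(1))
      then have "T q j = {} \<or> (\<exists>a. T q j = {a})" by blast
      then show ?thesis by auto
    qed
    moreover have "countable ((UNIV :: 'b set) \<times> ?s ` space M)"
      using Suc by (intro countable_SIGMA) (auto intro: countable_finite)
    ultimately show "countable (\<Union>q\<in>UNIV \<times> ?s ` space M. \<Union>j. T q j)"
      by (intro countable_UN) auto
  qed
  have t: "?t \<in> measurable (G (Suc k)) (count_space UNIV)"
  proof (rule measurable_count_space_countable_range)
    show "countable (?t ` space (G (Suc k)))" using range by (simp add: G_space)
    fix q :: "(real ^ 'n) \<times> real"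
    obtain z c where q: "q = (z, c)" by fastforce
    \<comment> \<open>An outcome is fixed by the draw, the previous state and whether
      \<open>R k\<close> lies in a certain interval; the reverse inclusion uses that the line search
      is deterministic.\<close>
    have "?t -` {q} \<inter> space (G (Suc k)) = (\<Union>a\<in>?s ` space M. \<Union>i. {\<omega>\<in>space M. I k \<omega> = i} \<inter>
        {\<omega>\<in>space M. ?s \<omega> = a} \<inter> (R k -` {r. LS i (fst a) r (snd a) c z} \<inter> space (G (Suc k))))"
      (is "?lhs = ?rhs")
    proof
      show "?lhs \<subseteq> ?rhs"
      proof
        fix \<omega> assume "\<omega> \<in> ?lhs"
        then have \<omega>: "\<omega> \<in> space M" and eq: "x (Suc k) \<omega> = z" "\<beta> (Suc k) \<omega> = c"
          by (auto simp: G_space q)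
        have "LS (I k \<omega>) (x k \<omega>) (R k \<omega>) (b k \<omega>) c z" using step(1)[OF \<omega>, of k] eq by simp
        then show "\<omega> \<in> ?rhs"
          using \<omega> by (intro UN_I[of "?s \<omega>"] UN_I[of "I k \<omega>"]) (auto simp: G_space)
      qed
      show "?rhs \<subseteq> ?lhs"
      proof
        fix \<omega> assume "\<omega> \<in> ?rhs"
        then have \<omega>: "\<omega> \<in> space M" and ls: "LS (I k \<omega>) (x k \<omega>) (R k \<omega>) (b k \<omega>) c z"
          by (auto simp: G_space)
        show "\<omega> \<in> ?lhs"
          using line_search_unique[OF x_dom[OF \<omega>] step(1)[OF \<omega>] ls b_pos[OF \<omega>]] \<omega>
          by (simp add: G_space q)
      qed
    qed
    also have "\<dots> \<in> sets (G (Suc k))"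
    proof -
      have "{\<omega>\<in>space M. I k \<omega> = i} \<inter> {\<omega>\<in>space M. ?s \<omega> = a} \<inter>
          (R k -` {r. LS i (fst a) r (snd a) c z} \<inter> space (G (Suc k))) \<in> sets (G (Suc k))"
        if "a \<in> ?s ` space M" for a i
      proof (rule sets.Int[OF sets.Int[OF draw_event s_set] measurable_sets[OF R]])
        show "{r. LS i (fst a) r (snd a) c z} \<in> sets borel"
          using that x_dom b_pos by (auto intro!: line_search_borel)
      qed
      then show ?thesis
        using Suc by (intro sets.countable_UN'') (auto intro: countable_finite)
    qed
    finally show "?t -` {q} \<inter> space (G (Suc k)) \<in> sets (G (Suc k))" .
  qed
  let ?w = "\<lambda>q. (fst q, max (snd q / 4) (\<beta>min / 2))"
  have w: "(x (Suc k) \<omega>, b (Suc k) \<omega>) = ?w (?t \<omega>)" if "\<omega> \<in> space M" for \<omega>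
    using step(5)[OF that] by simp
  have "(\<lambda>\<omega>. ?w (?t \<omega>)) \<in> measurable (G (Suc k)) (count_space UNIV)"
    by (rule measurable_compose[OF t]) simp
  then have "(\<lambda>\<omega>. (x (Suc k) \<omega>, b (Suc k) \<omega>)) \<in> measurable (G (Suc k)) (count_space UNIV)"
    using w by (subst measurable_cong[where g = "\<lambda>\<omega>. ?w (?t \<omega>)"]) (auto simp: G_space)
  moreover have "(\<lambda>\<omega>. (x (Suc k) \<omega>, b (Suc k) \<omega>)) ` space M = ?w ` ?t ` space M"
    using w by (simp add: image_image cong: image_cong)
  then have "countable ((\<lambda>\<omega>. (x (Suc k) \<omega>, b (Suc k) \<omega>)) ` space M)"
    using range by simp
  moreover have "R (Suc k) \<in> borel_measurable (G (Suc k))"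
  proof -
    have "(\<lambda>\<omega>. \<Phi> (fst (?t \<omega>))) \<in> borel_measurable (G (Suc k))"
      by (rule measurable_compose[OF t]) simp
    then have "(\<lambda>\<omega>. (1 - u (Suc k) \<omega>) * R k \<omega> + u (Suc k) \<omega> * \<Phi> (x (Suc k) \<omega>))
        \<in> borel_measurable (G (Suc k))"
      using u_meas[of k] R by simp
    then show ?thesis
      using R_Suc by (subst measurable_cong[where g = "\<lambda>\<omega>. (1 - u (Suc k) \<omega>) * R k \<omega> + u (Suc k) \<omega> * \<Phi> (x (Suc k) \<omega>)"])
        (auto simp: G_space)
  qed
  ultimately show ?case by blast
qed

lemma R_meas: "R k \<in> borel_measurable (G k)"
  using state_measurable by blast

text \<open>\<open>rho r0 e K i k\<close> bounds the residual of block \<open>i\<close> at \<open>x k\<close>: a draw of block \<open>i\<close> resets it, and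
  every step adds an error controlled by the decrease of the reference value.\<close>

primrec rho :: "real \<Rightarrow> real \<Rightarrow> real \<Rightarrow> 'b \<Rightarrow> nat \<Rightarrow> 'w \<Rightarrow> real" where
  "rho r0 e K i 0 \<omega> = r0"
| "rho r0 e K i (Suc k) \<omega> =
    (if I k \<omega> = i then 0 else rho r0 e K i k \<omega>) + e + K * (R k \<omega> - R (Suc k) \<omega>)"

section \<open>Expected residual bounds\<close>

lemma R_bounded_below: "\<exists>lo. \<forall>\<omega>\<in>space M. \<forall>k. lo \<le> R k \<omega>"
proof -
  obtain lo where lo: "\<And>y. y \<in> C \<Longrightarrow> ereal lo \<le> \<phi> y" using phi_bounded_below by blast
  have "lo \<le> R k \<omega>" if \<omega>: "\<omega> \<in> space M" for k \<omega>
    using lo[OF x_level[OF \<omega>, of k]] \<Phi>_le_R[OF \<omega>, of k] by (simp add: phi_\<Phi>[OF x_dom[OF \<omega>]])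
  then show ?thesis by blast
qed

lemma R_integrable: "integrable M (R k)"
proof -
  obtain lo where lo: "\<And>\<omega>. \<omega> \<in> space M \<Longrightarrow> lo \<le> R k \<omega>" using R_bounded_below by blast
  have "\<bar>R k \<omega>\<bar> \<le> max \<bar>lo\<bar> \<bar>\<Phi> x\<^sub>0\<bar>" if "\<omega> \<in> space M" for \<omega>
    using lo[OF that] R_le[OF that, of k] by linarith
  then show ?thesis
    by (intro integrable_const_bound[where B = "max \<bar>lo\<bar> \<bar>\<Phi> x\<^sub>0\<bar>"] G_to_M[OF R_meas]) auto
qed

lemma expected_R_decrement: "(\<lambda>k. expectation (R k) - expectation (R (Suc k))) \<longlonglongrightarrow> 0"
proof -
  obtain lo where lo: "\<And>\<omega> k. \<omega> \<in> space M \<Longrightarrow> lo \<le> R k \<omega>" using R_bounded_below by blast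
  have "decseq (\<lambda>k. expectation (R k))"
    by (rule decseq_SucI) (intro integral_mono R_integrable R_antimono)
  moreover have "lo \<le> expectation (R k)" for k
    using lo by (intro integral_ge_const R_integrable) auto
  ultimately obtain L where L: "(\<lambda>k. expectation (R k)) \<longlonglongrightarrow> L"
    using decseq_convergent by metis
  show ?thesis using tendsto_diff[OF L LIMSEQ_Suc[OF L]] by simp
qed

lemma rho_nonneg:
  assumes "0 \<le> r0" "0 \<le> e" "0 \<le> K" "\<omega> \<in> space M"
  shows "0 \<le> rho r0 e K i k \<omega>"
proof (induction k)
  case (Suc k)
  have "0 \<le> K * (R k \<omega> - R (Suc k) \<omega>)" using assms R_antimono by simp
  then show ?case using Suc assms(2) by simp
qed (simp add: assms)

text \<open>Serves runs that have stayed at the starting point, where the start value has to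
  dominate \<open>stat_dist\<close>.\<close>

lemma rho_ge_start:
  assumes "0 \<le> e" "0 \<le> K" "\<omega> \<in> space M"
  shows "\<forall>l<k. I l \<omega> \<noteq> i \<Longrightarrow> r0 \<le> rho r0 e K i k \<omega>"
proof (induction k)
  case (Suc k)
  have "0 \<le> K * (R k \<omega> - R (Suc k) \<omega>)" using assms R_antimono by simp
  then show ?case using Suc assms(1) by (simp add: add_increasing2)
qed simp

text \<open>The terms in \<open>R\<close> telescope and resets only lower the value; this crude
  growth in k suffices for integrability.\<close>

lemma rho_le:
  assumes "0 \<le> r0" "0 \<le> e" "0 \<le> K" "\<omega> \<in> space M"
  shows "rho r0 e K i k \<omega> \<le> r0 + real k * e + K * (\<Phi> x\<^sub>0 - R k \<omega>)"
proof (induction k)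
  case (Suc k)
  have "0 \<le> rho r0 e K i k \<omega>" by (rule rho_nonneg[OF assms])
  then have "rho r0 e K i (Suc k) \<omega> \<le> rho r0 e K i k \<omega> + e + K * (R k \<omega> - R (Suc k) \<omega>)" by simp
  also have "\<dots> \<le> r0 + real (Suc k) * e + K * (\<Phi> x\<^sub>0 - R (Suc k) \<omega>)"
    using Suc by (simp add: algebra_simps)
  finally show ?case .
qed (simp add: start assms)

lemma rho_measurable: "rho r0 e K i k \<in> borel_measurable (G k)"
proof (induction k)
  case (Suc k)
  have [measurable]: "rho r0 e K i k \<in> borel_measurable (G (Suc k))" "R k \<in> borel_measurable (G (Suc k))"
    "R (Suc k) \<in> borel_measurable (G (Suc k))" "I k \<in> measurable (G (Suc k)) (count_space UNIV)"
    using Suc R_meas I_meas by (auto intro: G_mono[of k])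
  show ?case by simp
qed simp

lemma rho_integrable:
  assumes "0 \<le> r0" "0 \<le> e" "0 \<le> K"
  shows "integrable M (rho r0 e K i k)"
proof -
  obtain lo where lo: "\<And>\<omega>. \<omega> \<in> space M \<Longrightarrow> lo \<le> R k \<omega>" using R_bounded_below by blast
  have "\<bar>rho r0 e K i k \<omega>\<bar> \<le> r0 + real k * e + K * (\<Phi> x\<^sub>0 - lo)" if \<omega>: "\<omega> \<in> space M" for \<omega>
  proof -
    have "K * (\<Phi> x\<^sub>0 - R k \<omega>) \<le> K * (\<Phi> x\<^sub>0 - lo)" using lo[OF \<omega>] assms(3) by (intro mult_left_mono) auto
    then show ?thesis using rho_le[OF assms \<omega>, of i k] rho_nonneg[OF assms \<omega>, of i k] by simp
  qed
  then show ?thesis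
    by (intro integrable_const_bound[where B = "r0 + real k * e + K * (\<Phi> x\<^sub>0 - lo)"] G_to_M[OF rho_measurable]) auto
qed

text \<open>The value of \<open>rho\<close> at time k is known before the draw, so the reset removes
  the fraction \<open>p i\<close> of its expectation. The decrement of \<open>R\<close> does depend
  on the draw, but it is added outside the case distinction and enters through its expectation
  alone.\<close>

lemma expectation_rho_Suc:
  assumes "0 \<le> r0" "0 \<le> e" "0 \<le> K"
  shows "expectation (rho r0 e K i (Suc k)) = (1 - p i) * expectation (rho r0 e K i k) + e
    + K * (expectation (R k) - expectation (R (Suc k)))"
proof -
  let ?E = "{\<omega>\<in>space M. I k \<omega> = i}" and ?r = "rho r0 e K i k"
  note int = rho_integrable[OF assms, of i k]
  have intE: "integrable M (\<lambda>\<omega>. indicator ?E \<omega> * ?r \<omega>)"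
    using integrable_real_mult_indicator[OF draw_event_M int] by (simp add: mult.commute)
  have "expectation (rho r0 e K i (Suc k))
      = expectation (\<lambda>\<omega>. ?r \<omega> - indicator ?E \<omega> * ?r \<omega> + e + K * (R k \<omega> - R (Suc k) \<omega>))"
    by (intro Bochner_Integration.integral_cong) (auto simp: indicator_def)
  also have "\<dots> = expectation ?r - expectation (\<lambda>\<omega>. indicator ?E \<omega> * ?r \<omega>) + e
      + K * (expectation (R k) - expectation (R (Suc k)))"
    using int intE R_integrable by (simp add: prob_space)
  also have "expectation (\<lambda>\<omega>. indicator ?E \<omega> * ?r \<omega>) = p i * expectation ?r"
    using p_pos[of i]
    by (intro integral_over_independent_event[OF G_sub draw_event_M _ draw rho_measurable]) auto
  finally show ?thesis by (simp add: algebra_simps del: rho.simps)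
qed

lemma expectation_rho_eventually_le:
  assumes "0 \<le> r0" "0 < e" "0 \<le> K"
  shows "eventually (\<lambda>k. expectation (rho r0 e K i k) \<le> 3 * e / pmin) sequentially"
proof -
  have "eventually (\<lambda>k. expectation (rho r0 e K i k) \<le> 3 * e / p i) sequentially"
  proof (rule affine_recursion_eventually_le[OF p_pos p_le_1 \<open>0 < e\<close>])
    show "expectation (rho r0 e K i (Suc k)) \<le> (1 - p i) * expectation (rho r0 e K i k) + e
        + K * (expectation (R k) - expectation (R (Suc k)))" for k
      using assms by (simp add: expectation_rho_Suc del: rho.simps)
    show "(\<lambda>k. K * (expectation (R k) - expectation (R (Suc k)))) \<longlonglongrightarrow> 0"
      by (rule tendsto_mult_right_zero[OF expected_R_decrement])
  qed
  moreover have "3 * e / p i \<le> 3 * e / pmin"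
    using params(4) params(5)[of i] \<open>0 < e\<close> by (intro divide_left_mono) auto
  ultimately show ?thesis by (auto elim: eventually_mono)
qed

text \<open>At an iterate with an undrawn block at which \<open>g i\<close> has no subgradient, the subdifferential is
  empty unless the algorithm has not moved at all; the start value \<open>r0\<close> covers the latter case.\<close>

lemma stat_dist_le_rho:
  assumes e: "0 < e"
  shows "\<exists>r0\<ge>0. \<exists>K\<ge>0. \<forall>\<omega>\<in>space M. \<forall>k. stat_dist \<phi> (x k \<omega>) \<le> (\<Sum>i\<in>UNIV. rho r0 e K i k \<omega>)"
proof -
  obtain B where B: "0 \<le> B" "\<And>\<omega> k. \<omega> \<in> space M \<Longrightarrow> \<beta> (Suc k) \<omega> \<le> B" using \<beta>_bounded by blast
  obtain K where K: "K \<ge> 0"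
    "\<And>y z l \<rho>. y \<in> C \<Longrightarrow> z \<in> C \<Longrightarrow> bp l z = bp l y \<Longrightarrow> resid l y \<rho> \<Longrightarrow>
      resid l z (\<rho> + e + K * (norm (z - y))\<^sup>2)"
    "\<And>y z i \<beta>. y \<in> C \<Longrightarrow> z \<in> C \<Longrightarrow> 0 \<le> \<beta> \<Longrightarrow> \<beta> \<le> B \<Longrightarrow> trial_point blk f F h g i y \<beta> z \<Longrightarrow>
      resid i z (e + K * (norm (z - y))\<^sup>2)"
    using resid_step[OF e B(1)] by metis
  define c where "c = umin * \<beta>min / 2"
  \<comment> \<open>The decrease of \<open>R\<close> is at least c times the squared step; dividing
    by c expresses the step error through it.\<close>
  define K' where "K' = K / c"
  have c: "0 < c" using params(1,3) by (simp add: c_def)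
  have K': "0 \<le> K'" using K(1) c by (simp add: K'_def)
  have step_le: "K * (norm (x (Suc k) \<omega> - x k \<omega>))\<^sup>2 \<le> K' * (R k \<omega> - R (Suc k) \<omega>)"
    if \<omega>: "\<omega> \<in> space M" for \<omega> k
  proof -
    have "K' * (c * (norm (x (Suc k) \<omega> - x k \<omega>))\<^sup>2) \<le> K' * (R k \<omega> - R (Suc k) \<omega>)"
      using R_step(2)[OF \<omega>, of k] K' by (intro mult_left_mono) (auto simp: c_def)
    then show ?thesis using c by (simp add: K'_def)
  qed
  \<comment> \<open>For a block without a subgradient at the start the implication is vacuous, so
    one choice of bounds covers all blocks.\<close>
  have "\<exists>\<rho>. (\<exists>v. subgrad i x\<^sub>0 v) \<longrightarrow> resid i x\<^sub>0 \<rho>" for i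
    unfolding resid_def by blast
  then obtain \<rho> where \<rho>: "\<And>i v. subgrad i x\<^sub>0 v \<Longrightarrow> resid i x\<^sub>0 (\<rho> i)" by metis
  \<comment> \<open>The first summand serves runs that have not moved, the second the blocks with a
    subgradient at the start.\<close>
  define r0 where "r0 = stat_dist \<phi> x\<^sub>0 + (\<Sum>i\<in>UNIV. \<bar>\<rho> i\<bar>)"
  have sd: "0 \<le> stat_dist \<phi> x\<^sub>0" by (simp add: stat_dist_def infdist_nonneg)
  have r0: "0 \<le> r0" "stat_dist \<phi> x\<^sub>0 \<le> r0" using sd by (simp_all add: r0_def sum_nonneg)
  have \<rho>r0: "\<rho> i \<le> r0" for i
    using member_le_sum[of i UNIV "\<lambda>i. \<bar>\<rho> i\<bar>"] sd by (simp add: r0_def)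
  have resid: "resid i (x k \<omega>) (rho r0 e K' i k \<omega>)"
    if \<omega>: "\<omega> \<in> space M" and "(\<exists>l<k. I l \<omega> = i) \<or> (\<exists>v. subgrad i x\<^sub>0 v)" for i k \<omega>
    using that(2)
  proof (induction k)
    case 0
    then show ?case using resid_mono[OF \<rho> \<rho>r0] by (auto simp: start[OF \<omega>])
  next
    case (Suc k)
    note xC = x_level[OF \<omega>, of k] x_level[OF \<omega>, of "Suc k"]
    show ?case
    proof (cases "I k \<omega> = i")
      case True
      have "resid i (x (Suc k) \<omega>) (e + K * (norm (x (Suc k) \<omega> - x k \<omega>))\<^sup>2)"
        using line_search_stopped[OF step(1)[OF \<omega>, of k]] True \<beta>_ge[OF \<omega>, of k] params(1)
        by (intro K(3)[OF xC _ B(2)[OF \<omega>]]) auto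
      then show ?thesis by (rule resid_mono) (use True step_le[OF \<omega>, of k] in simp)
    next
      case False
      then have "resid i (x k \<omega>) (rho r0 e K' i k \<omega>)" using Suc by (auto simp: less_Suc_eq)
      then have "resid i (x (Suc k) \<omega>) (rho r0 e K' i k \<omega> + e + K * (norm (x (Suc k) \<omega> - x k \<omega>))\<^sup>2)"
        using x_Suc_other[OF \<omega>, of i k] False by (intro K(2)[OF xC]) simp_all
      then show ?thesis by (rule resid_mono) (use False step_le[OF \<omega>, of k] in simp)
    qed
  qed
  have "stat_dist \<phi> (x k \<omega>) \<le> (\<Sum>i\<in>UNIV. rho r0 e K' i k \<omega>)" if \<omega>: "\<omega> \<in> space M" for \<omega> k
  proof (cases "\<forall>i. (\<exists>l<k. I l \<omega> = i) \<or> (\<exists>v. subgrad i x\<^sub>0 v)")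
    case True
    then show ?thesis by (intro stat_dist_le(2)[OF x_dom[OF \<omega>]] resid[OF \<omega>]) blast
  next
    case False
    then obtain i where i: "\<forall>l<k. I l \<omega> \<noteq> i" "\<nexists>v. subgrad i x\<^sub>0 v" by blast
    have rho0: "0 \<le> rho r0 e K' l k \<omega>" for l using rho_nonneg[OF r0(1) _ K' \<omega>] e by simp
    show ?thesis
    proof (cases "\<phi> (x k \<omega>) < \<phi> x\<^sub>0")
      case True
      have "\<not> subgrad i (x k \<omega>) v" for v
        using i(2) undrawn_block[OF \<omega> i(1)] by (simp add: subgrad_def)
      then have "limiting_subdiff \<phi> (x k \<omega>) = {}"
        using limiting_subdiff_imp_subgrad[OF True] by blast
      \<comment> \<open>The distance to the empty set is 0 by convention.\<close>
      then show ?thesis using rho0 by (simp add: stat_dist_def infdist_def sum_nonneg)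
    next
      case False
      then have "\<Phi> (x k \<omega>) = \<Phi> x\<^sub>0"
        using x_level[OF \<omega>, of k] by (simp add: phi_\<Phi> x_dom[OF \<omega>] x0_dom')
      then have "x k \<omega> = x\<^sub>0" by (rule x_eq_start[OF \<omega>])
      then have "stat_dist \<phi> (x k \<omega>) \<le> rho r0 e K' i k \<omega>"
        using r0(2) rho_ge_start[OF _ K' \<omega> i(1), of e r0] e by simp
      also have "\<dots> \<le> (\<Sum>i\<in>UNIV. rho r0 e K' i k \<omega>)" using rho0 by (intro member_le_sum) auto
      finally show ?thesis .
    qed
  qed
  then show ?thesis using r0(1) K' by blast
qed

lemma expected_stat_dist_tendsto_0:
  "(\<lambda>k. \<integral>\<^sup>+\<omega>. ennreal (stat_dist \<phi> (x k \<omega>)) \<partial>M) \<longlonglongrightarrow> 0"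
proof (rule order_tendstoI)
  fix a :: ennreal assume "0 < a"
  \<comment> \<open>The target may be infinite; d is a positive real below it.\<close>
  then obtain d' where "0 < d'" "d' < a" using dense by blast
  then obtain d where d: "0 < d" "ennreal d < a" by (cases d') auto
  define N where "N = real CARD('b)"
  \<comment> \<open>Chosen so that the bounds 3 e / pmin of all N blocks add up to d.\<close>
  define e where "e = d * pmin / (3 * N)"
  have N: "0 < N" by (simp add: N_def)
  have e: "0 < e" using d params(4) N by (simp add: e_def)
  obtain r0 K where rK: "0 \<le> r0" "0 \<le> K"
    "\<And>\<omega> k. \<omega> \<in> space M \<Longrightarrow> stat_dist \<phi> (x k \<omega>) \<le> (\<Sum>i\<in>UNIV. rho r0 e K i k \<omega>)"
    using stat_dist_le_rho[OF e] by metis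
  have int: "integrable M (rho r0 e K i k)" for i k
    using rho_integrable[OF rK(1) _ rK(2)] e by simp
  have "eventually (\<lambda>k. \<forall>i. expectation (rho r0 e K i k) \<le> 3 * e / pmin) sequentially"
    using expectation_rho_eventually_le[OF rK(1) e rK(2)] by (simp add: eventually_all_finite)
  then show "eventually (\<lambda>k. (\<integral>\<^sup>+\<omega>. ennreal (stat_dist \<phi> (x k \<omega>)) \<partial>M) < a) sequentially"
  proof eventually_elim
    case (elim k)
    have "(\<integral>\<^sup>+\<omega>. ennreal (stat_dist \<phi> (x k \<omega>)) \<partial>M)
        \<le> (\<integral>\<^sup>+\<omega>. ennreal (\<Sum>i\<in>UNIV. rho r0 e K i k \<omega>) \<partial>M)"
      using rK(3) by (intro nn_integral_mono ennreal_leI)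
    also have "\<dots> = ennreal (expectation (\<lambda>\<omega>. \<Sum>i\<in>UNIV. rho r0 e K i k \<omega>))"
      using e by (intro nn_integral_eq_integral Bochner_Integration.integrable_sum int AE_I2 sum_nonneg
          rho_nonneg rK(1,2)) auto
    also have "expectation (\<lambda>\<omega>. \<Sum>i\<in>UNIV. rho r0 e K i k \<omega>) = (\<Sum>i\<in>UNIV. expectation (rho r0 e K i k))"
      by (intro Bochner_Integration.integral_sum int)
    also have "\<dots> \<le> (\<Sum>i\<in>(UNIV :: 'b set). 3 * e / pmin)" using elim by (intro sum_mono) auto
    also have "\<dots> = d" using params(4) N by (simp add: e_def N_def)
    finally show ?case using d(2) by (auto simp: ennreal_leI intro: le_less_trans)
  qed
qed simp

section \<open>Probability of an empty subdifferential\<close>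

lemma sets_G_events: "A \<in> sets (G k) \<Longrightarrow> A \<in> events"
  using G_sub by (auto simp: subalgebra_def)

text \<open>Measurability and probability are proved together, because independence of draw k
  applies to events of \<open>G k\<close>.\<close>

lemma prob_undrawn:
  "{\<omega>\<in>space M. \<forall>l<k. I l \<omega> \<noteq> i} \<in> sets (G k) \<and>
   prob {\<omega>\<in>space M. \<forall>l<k. I l \<omega> \<noteq> i} = (1 - p i) ^ k"
proof (induction k)
  case 0
  show ?case using sets.top[of "G 0"] by (simp add: G_space prob_space)
next
  case (Suc k)
  let ?A = "{\<omega>\<in>space M. \<forall>l<k. I l \<omega> \<noteq> i}" and ?E = "{\<omega>\<in>space M. I k \<omega> = i}"
  have eq: "{\<omega>\<in>space M. \<forall>l<Suc k. I l \<omega> \<noteq> i} = ?A - ?A \<inter> ?E" by (auto simp: less_Suc_eq)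
  have "?A \<in> sets (G (Suc k))"
    by (rule subsetD[OF filtration.sets_F_mono[OF G_filtration] conjunct1[OF Suc]]) simp
  then have meas: "?A - ?A \<inter> ?E \<in> sets (G (Suc k))"
    by (intro sets.Diff sets.Int draw_event)
  have A: "?A \<in> events" by (rule sets_G_events[OF conjunct1[OF Suc]])
  have "prob (?A - ?A \<inter> ?E) = prob ?A - prob (?A \<inter> ?E)"
    by (rule finite_measure_Diff[OF A sets.Int[OF A draw_event_M]]) simp
  also have "\<dots> = (1 - p i) ^ Suc k"
    unfolding draw[OF conjunct1[OF Suc]] conjunct2[OF Suc] by (simp add: algebra_simps)
  finally show ?case unfolding eq by (rule conjI[OF meas])
qed

text \<open>A drawn block has a subgradient by optimality of the trial point and keeps it while
  other blocks move. An empty subdifferential thus requires a block not drawn so far, and a union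
  bound over the blocks gives geometric decay.\<close>

lemma prob_no_subgradient_tendsto_0:
  "(\<lambda>k. prob {\<omega> \<in> space M. limiting_subdiff \<phi> (x k \<omega>) = {}}) \<longlonglongrightarrow> 0"
proof (rule tendsto_sandwich[OF always_eventually always_eventually tendsto_const])
  let ?U = "\<lambda>k i. {\<omega>\<in>space M. \<forall>l<k. I l \<omega> \<noteq> i}"
  have U: "?U k i \<in> events" for k i
    by (rule sets_G_events[OF conjunct1[OF prob_undrawn]])
  show "\<forall>k. prob {\<omega> \<in> space M. limiting_subdiff \<phi> (x k \<omega>) = {}} \<le> (\<Sum>i\<in>UNIV. (1 - p i) ^ k)"
  proof
    fix k
    obtain B where B: "0 \<le> B" "\<And>\<omega> k. \<omega> \<in> space M \<Longrightarrow> \<beta> (Suc k) \<omega> \<le> B" using \<beta>_bounded by blast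
    have "{\<omega> \<in> space M. limiting_subdiff \<phi> (x k \<omega>) = {}} \<subseteq> (\<Union>i. ?U k i)"
    proof
      fix \<omega> assume \<omega>: "\<omega> \<in> {\<omega> \<in> space M. limiting_subdiff \<phi> (x k \<omega>) = {}}"
      have "\<exists>i. \<forall>v. \<not> subgrad i (x k \<omega>) v"
      proof (rule ccontr)
        assume "\<nexists>i. \<forall>v. \<not> subgrad i (x k \<omega>) v"
        then obtain v where "\<And>i. subgrad i (x k \<omega>) (v i)" by metis
        then show False using limiting_subdiff_from_subgrads[OF x_dom, of \<omega> k v] \<omega> by auto
      qed
      then obtain i where i: "\<And>v. \<not> subgrad i (x k \<omega>) v" by blast
      have "\<exists>v. subgrad i (x m \<omega>) v" if "\<exists>l<m. I l \<omega> = i" for m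
        using that
      proof (induction m)
        case (Suc m)
        show ?case
        proof (cases "I m \<omega> = i")
          case True
          then show ?thesis
            using \<omega> line_search_stopped[OF step(1)] trial_point_subgrad[OF x_dom] by blast
        next
          case False
          then show ?thesis
            using Suc \<omega> x_Suc_other[of \<omega> i m] by (auto simp: subgrad_def less_Suc_eq)
        qed
      qed simp
      then show "\<omega> \<in> (\<Union>i. ?U k i)" using i \<omega> by blast
    qed
    then have "prob {\<omega> \<in> space M. limiting_subdiff \<phi> (x k \<omega>) = {}} \<le> prob (\<Union>i. ?U k i)"
      by (rule finite_measure_mono[OF _ sets.finite_UN[OF finite U]])
    also have "\<dots> \<le> (\<Sum>i\<in>UNIV. prob (?U k i))"
      by (rule finite_measure_subadditive_finite[OF finite]) (use U in blast)
    finally show "prob {\<omega> \<in> space M. limiting_subdiff \<phi> (x k \<omega>) = {}} \<le> (\<Sum>i\<in>UNIV. (1 - p i) ^ k)"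
      unfolding conjunct2[OF prob_undrawn] .
  qed
  have "(\<lambda>k. (1 - p i) ^ k) \<longlonglongrightarrow> 0" for i
    using p_pos[of i] p_le_1[of i] by (intro LIMSEQ_realpow_zero) auto
  then show "(\<lambda>k. \<Sum>i\<in>UNIV. (1 - p i) ^ k) \<longlonglongrightarrow> 0" by (intro tendsto_null_sum)
qed simp

end

theorem proposition4p1:
  fixes blk :: "'n::finite \<Rightarrow> 'b::finite"
    and f :: "real ^ 'n \<Rightarrow> real"
    and F :: "real ^ 'n \<Rightarrow> real ^ 'm::finite"
    and h :: "real ^ 'm \<Rightarrow> real"
    and g :: "'b \<Rightarrow> real ^ 'n \<Rightarrow> ereal"
    and \<phi> :: "real ^ 'n \<Rightarrow> ereal"
    and M :: "'w measure"
    and x :: "nat \<Rightarrow> 'w \<Rightarrow> real ^ 'n"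
  assumes phi: "\<phi> = objective blk f F h g"
    and f_diff: "\<And>y. y \<in> edom \<phi> \<Longrightarrow> f differentiable (at y)"
    and F_diff: "\<And>y. y \<in> edom \<phi> \<Longrightarrow> F differentiable (at y)"
    and libcod: "nonmonotone_libcod blk f F h g x\<^sub>0 \<beta>\<^sub>1 \<beta>min pmin umin p M G I u b \<beta> R x"
    and level_compact: "compact {y. \<phi> y \<le> \<phi> x\<^sub>0}"
    and assm_A: "assumption_A blk f F h g {y. \<phi> y \<le> \<phi> x\<^sub>0}"
    and g_affine: "\<exists>a c. \<forall>y. ereal (a \<bullet> y + c) \<le> block_sum blk g y"
  shows "(\<lambda>k. \<integral>\<^sup>+\<omega>. ennreal (stat_dist \<phi> (x k \<omega>)) \<partial>M) \<longlonglongrightarrow> 0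
       \<and> (\<lambda>k. measure M {\<omega> \<in> space M. limiting_subdiff \<phi> (x k \<omega>) = {}}) \<longlonglongrightarrow> 0"
proof -
  have "x\<^sub>0 \<in> edom \<phi>" using libcod by (simp add: nonmonotone_libcod_def phi)
  then interpret run: libcod_run blk f F h g x\<^sub>0 \<beta>\<^sub>1 \<beta>min pmin umin p M G I u b \<beta> R x
    using assms by unfold_locales auto
  have "run.\<phi> = \<phi>" by (simp add: run.\<phi>_def phi)
  then show ?thesis
    using run.expected_stat_dist_tendsto_0 run.prob_no_subgradient_tendsto_0 by simp
qed

end
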